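(* Let $\varrho$ be a state of an $N$-qubit system with von Neumann entropy $S=S(\varrho)$. Then $N+S$ pure qubits (per copy, asymptotically) are necessary and sufficient to produce $\varrho$ if one does not have access to noise. That is, the infimum of $\lim_{n\to\infty}k_n/n$ over all sequences of nonnegative integers $(k_n)$ for which this limit exists and for which there are operations $\Lambda_n$ composed of unitary transformations and partial traces only, taking states of $k_n$ qubits to states of $nN$ qubits, with $\|\Lambda_n(\pi^{\otimes k_n})-\varrho^{\otimes n}\|\to0$, is equal to $N+S(\varrho)$.
   Context: Here $\pi$ is a pure state of one qubit, $S(\varrho)=-\mathrm{Tr}\,\varrho\log\varrho$ with logarithm base $2$, and $\|\cdot\|$ is the trace norm. A state of $N$ qubits is a positive semidefinite operator of trace $1$ on $(\mathbb{C}^2)^{\otimes N}$. "Without access to noise" means that no ancillas are free: the only allowed operations are unitary transformations of the qubits present and discarding (partial trace over) qubits, and every pure qubit used is counted. *)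

theory Defs
  imports
    Complex_Main
    "HOL-Library.Extended_Real"
    "Jordan_Normal_Form.Schur_Decomposition"
begin

(* Operators on the N-qubit space (C^2)^{(x) N} are complex 2^N x 2^N matrices in the
   computational basis.  A basis index is read as a binary string whose first
   (most significant) digit belongs to the first qubit. *)

definition mat_trace :: "complex mat \<Rightarrow> complex" where
  "mat_trace A = (\<Sum>i<dim_row A. A $$ (i, i))"

definition unitary_mat :: "nat \<Rightarrow> complex mat \<Rightarrow> bool" where
  "unitary_mat d U \<longleftrightarrow>
     U \<in> carrier_mat d d \<and> U * mat_adjoint U = 1\<^sub>m d \<and> mat_adjoint U * U = 1\<^sub>m d"

(* 0 \<le> z for complex z (Complex_Order) says that z is real and nonnegative; over the
   complex numbers this condition already forces A to be Hermitian. *)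
definition positive_semidefinite :: "nat \<Rightarrow> complex mat \<Rightarrow> bool" where
  "positive_semidefinite d A \<longleftrightarrow>
     A \<in> carrier_mat d d \<and> (\<forall>v \<in> carrier_vec d. 0 \<le> (A *\<^sub>v v) \<bullet>c v)"

definition qubit_state :: "nat \<Rightarrow> complex mat \<Rightarrow> bool" where
  "qubit_state N \<rho> \<longleftrightarrow> positive_semidefinite (2 ^ N) \<rho> \<and> mat_trace \<rho> = 1"

definition outer_prod :: "complex vec \<Rightarrow> complex vec \<Rightarrow> complex mat" where
  "outer_prod v w = mat (dim_vec v) (dim_vec w) (\<lambda>(i, j). v $ i * cnj (w $ j))"

definition pure_qubit :: "complex mat \<Rightarrow> bool" where
  "pure_qubit \<pi> \<longleftrightarrow> (\<exists>\<psi> \<in> carrier_vec 2. \<psi> \<bullet>c \<psi> = 1 \<and> \<pi> = outer_prod \<psi> \<psi>)"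

definition tensor_mat :: "complex mat \<Rightarrow> complex mat \<Rightarrow> complex mat" (infixr "\<otimes>\<^sub>m" 70) where
  "A \<otimes>\<^sub>m B = mat (dim_row A * dim_row B) (dim_col A * dim_col B)
     (\<lambda>(i, j). A $$ (i div dim_row B, j div dim_col B) * B $$ (i mod dim_row B, j mod dim_col B))"

primrec tensor_power :: "complex mat \<Rightarrow> nat \<Rightarrow> complex mat" where
  "tensor_power A 0 = 1\<^sub>m 1"
| "tensor_power A (Suc n) = A \<otimes>\<^sub>m tensor_power A n"

(* Functional calculus: f applied to the real eigenvalues of a Hermitian matrix A, in any
   unitary diagonalisation of A.  The result is independent of the diagonalisation
   (lemma hermitian_fun_eq); on non-Hermitian A it is unspecified. *)
definition hermitian_fun :: "(real \<Rightarrow> real) \<Rightarrow> complex mat \<Rightarrow> complex mat" where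
  "hermitian_fun f A = (THE B. \<exists>U l. unitary_mat (dim_row A) U \<and>
     A = U * mat_diag (dim_row A) (\<lambda>i. complex_of_real (l i)) * mat_adjoint U \<and>
     B = U * mat_diag (dim_row A) (\<lambda>i. complex_of_real (f (l i))) * mat_adjoint U)"

(* The convention 0 log 0 = 0 is respected: log 2 0 is a real number and each eigenvalue
   0 of log \<rho> is multiplied by the eigenvalue 0 of \<rho>. *)
definition von_neumann_entropy :: "complex mat \<Rightarrow> real" where
  "von_neumann_entropy \<rho> = - Re (mat_trace (\<rho> * hermitian_fun (log 2) \<rho>))"

definition trace_norm :: "complex mat \<Rightarrow> real" where
  "trace_norm A = Re (mat_trace (hermitian_fun sqrt (mat_adjoint A * A)))"

(* Partial trace over the middle qubit of C^{2^p} (x) C^2 (x) C^{2^q}; the index of the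
   basis vector e_x (x) e_b (x) e_y is (2 * x + b) * 2 ^ q + y. *)
definition discard_qubit :: "nat \<Rightarrow> nat \<Rightarrow> complex mat \<Rightarrow> complex mat" where
  "discard_qubit p q A = mat (2 ^ (p + q)) (2 ^ (p + q))
     (\<lambda>(i, j). \<Sum>b<2. A $$ ((2 * (i div 2 ^ q) + b) * 2 ^ q + i mod 2 ^ q,
                            (2 * (j div 2 ^ q) + b) * 2 ^ q + j mod 2 ^ q))"

(* noiseless_op k m \<Lambda>: the map \<Lambda> from k-qubit to m-qubit operators is a composition of
   unitary transformations of the qubits present and partial traces over qubits. *)
inductive noiseless_op :: "nat \<Rightarrow> nat \<Rightarrow> (complex mat \<Rightarrow> complex mat) \<Rightarrow> bool" where
  unitary: "unitary_mat (2 ^ k) U \<Longrightarrow> noiseless_op k k (\<lambda>\<rho>. U * \<rho> * mat_adjoint U)"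
| discard: "noiseless_op (p + 1 + q) (p + q) (discard_qubit p q)"
| compose: "noiseless_op k l \<Lambda> \<Longrightarrow> noiseless_op l m \<Lambda>' \<Longrightarrow> noiseless_op k m (\<lambda>\<rho>. \<Lambda>' (\<Lambda> \<rho>))"

definition achievable_rates :: "complex mat \<Rightarrow> nat \<Rightarrow> complex mat \<Rightarrow> real set" where
  "achievable_rates \<pi> N \<rho> = {r. \<exists>(k :: nat \<Rightarrow> nat) \<Lambda>.
     (\<lambda>n. real (k n) / real n) \<longlonglongrightarrow> r \<and>
     (\<forall>n\<ge>1. noiseless_op (k n) (n * N) (\<Lambda> n)) \<and>
     (\<lambda>n. trace_norm (\<Lambda> n (tensor_power \<pi> (k n)) - tensor_power \<rho> n)) \<longlonglongrightarrow> 0}"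

lemma mat_adjoint_carrier: "U \<in> carrier_mat n m \<Longrightarrow> mat_adjoint U \<in> carrier_mat m n"
  unfolding mat_adjoint_def by auto

lemma hermitian_fun_eq:
  assumes U: "unitary_mat d U"
    and A: "A = U * mat_diag d (\<lambda>i. complex_of_real (l i)) * mat_adjoint U"
  shows "hermitian_fun f A = U * mat_diag d (\<lambda>i. complex_of_real (f (l i))) * mat_adjoint U"
proof -
  have unique: "V * mat_diag d (\<lambda>i. complex_of_real (f (e i))) * mat_adjoint V =
      U * mat_diag d (\<lambda>i. complex_of_real (f (l i))) * mat_adjoint U"
    if V: "unitary_mat d V"
      and eq: "A = V * mat_diag d (\<lambda>i. complex_of_real (e i)) * mat_adjoint V" for V e
  proof -
    let ?D = "\<lambda>g. mat_diag d (\<lambda>i. complex_of_real (g i))"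
    have Uc: "U \<in> carrier_mat d d" "mat_adjoint U \<in> carrier_mat d d"
      and U1: "U * mat_adjoint U = 1\<^sub>m d" "mat_adjoint U * U = 1\<^sub>m d"
      using U mat_adjoint_carrier unfolding unitary_mat_def by auto
    have Vc: "V \<in> carrier_mat d d" "mat_adjoint V \<in> carrier_mat d d"
      and V1: "V * mat_adjoint V = 1\<^sub>m d" "mat_adjoint V * V = 1\<^sub>m d"
      using V mat_adjoint_carrier unfolding unitary_mat_def by auto
    have Dc: "?D g \<in> carrier_mat d d" for g by simp
    define W where "W = mat_adjoint V * U"
    have Wc: "W \<in> carrier_mat d d" unfolding W_def using Uc Vc by (metis mult_carrier_mat)
    note assoc = assoc_mult_mat[where n\<^sub>1 = d and n\<^sub>2 = d and n\<^sub>3 = d and n\<^sub>4 = d]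
    note carr = Uc Vc Dc Wc mult_carrier_mat[where nr = d and n = d and nc = d]
      left_mult_one_mat[where nr = d and nc = d] right_mult_one_mat[where nr = d and nc = d]
    have VW: "V * W = U"
      unfolding W_def by (simp add: assoc[symmetric] carr V1)
    have WU: "W * mat_adjoint U = mat_adjoint V"
      unfolding W_def by (simp add: assoc carr U1)
    have "W * ?D l = mat_adjoint V * (U * ?D l * mat_adjoint U) * U"
    proof -
      have "U * ?D l * mat_adjoint U * U = U * ?D l"
        by (simp add: assoc carr U1)
      then show ?thesis unfolding W_def by (simp add: assoc carr)
    qed
    also have "\<dots> = mat_adjoint V * (V * ?D e * mat_adjoint V) * U"
      using A eq by simp
    also have "\<dots> = ?D e * W"
    proof -
      have "mat_adjoint V * (V * ?D e * mat_adjoint V) = mat_adjoint V * V * ?D e * mat_adjoint V"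
        by (simp add: assoc carr)
      then have "mat_adjoint V * (V * ?D e * mat_adjoint V) = ?D e * mat_adjoint V"
        by (simp add: carr V1)
      then show ?thesis unfolding W_def by (simp add: assoc carr)
    qed
    finally have comm: "W * ?D l = ?D e * W" .
    have entry: "W $$ (i, j) * complex_of_real (l j) = complex_of_real (e i) * W $$ (i, j)"
      if "i < d" "j < d" for i j
      using arg_cong[OF comm, of "\<lambda>M. M $$ (i, j)"] that
      unfolding mat_diag_mult_left[OF Wc] mat_diag_mult_right[OF Wc] by simp
    have "W $$ (i, j) * complex_of_real (f (l j)) = complex_of_real (f (e i)) * W $$ (i, j)"
      if "i < d" "j < d" for i j
      using entry[OF that] by (cases "W $$ (i, j) = 0") auto
    then have commf: "W * ?D (\<lambda>i. f (l i)) = ?D (\<lambda>i. f (e i)) * W"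
      unfolding mat_diag_mult_left[OF Wc] mat_diag_mult_right[OF Wc]
      by (intro eq_matI) auto
    have "V * ?D (\<lambda>i. f (e i)) * mat_adjoint V = V * (?D (\<lambda>i. f (e i)) * W) * mat_adjoint U"
      unfolding WU[symmetric] by (simp add: assoc carr)
    also have "\<dots> = V * W * ?D (\<lambda>i. f (l i)) * mat_adjoint U"
      unfolding commf[symmetric] by (simp add: assoc carr)
    finally show ?thesis unfolding VW .
  qed
  have d: "dim_row A = d"
    using U unfolding A unitary_mat_def by auto
  show ?thesis
    unfolding hermitian_fun_def d by (rule the_equality) (use U A unique in blast)+
qed

end

theory Submission
  imports Defs "Jordan_Normal_Form.Spectral_Radius"
begin

text \<open>A noiseless operation turns the pure state of \<open>k\<close> qubits into \<open>V V\<^sup>*\<close> with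
  \<open>V\<close> having only \<open>2\<^bsup>k - m\<^esup>\<close> columns, i.e. a state of rank at most \<open>2\<^bsup>k - m\<^esup>\<close> on \<open>m\<close> qubits.
  By the law of large numbers for \<open>- log \<lambda>\<close>, all but a vanishing part of the trace of
  \<open>\<rho>\<^bsup>\<otimes>n\<^esup>\<close> sits on eigenvalues below \<open>2\<^bsup>- n (S - \<epsilon>)\<^esup>\<close>; the projector onto the support of a state
  of rank \<open>r\<close> therefore captures at most \<open>r 2\<^bsup>- n (S - \<epsilon>)\<^esup> + o(1)\<close> of it, so closeness in trace norm
  forces \<open>k - n N \<ge> n (S - \<epsilon>)\<close> eventually. Conversely, \<open>\<rho>\<^bsup>\<otimes>n\<^esup>\<close> restricted to its at most
  \<open>2\<^bsup>n (S + \<epsilon>)\<^esup>\<close> typical eigenvectors and renormalised is purified by \<open>n (S + \<epsilon>)\<close> further qubits;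
  one unitary creates the purification and the extra qubits are discarded.\<close>

section \<open>Unitary diagonal form\<close>

text \<open>The summand \<open>N\<close> of the rate reflects the absence of free ancillas: no
  operation adds a qubit, so all \<open>n * N\<close> output qubits are present from the start and
  only the remaining ones can be traced out. For the converse a factor \<open>V\<close> of the state
  is carried through the operation instead of its entropy: its number of columns changes in a
  controlled way at each step, and no continuity of entropy is involved. The trace norm is defined
  by functional calculus, so it is always evaluated in a diagonalising basis. In the converse the
  spectral theorem diagonalises the difference of the two states; in the direct part the
  approximating state keeps the eigenbasis of the tensor power, and the norm becomes an l1 distance
  between two lists of eigenvalues. What remains is classical: Chebyshev's inequality for a sum of
  independent surprisals, with error of order 1/n. Zero eigenvalues, where the logarithm is a
  default value, stay harmless because they enter only with weight zero.\<close>

lemma mat_adjoint_index [simp]: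
  assumes "i < dim_col A" "j < dim_row A"
  shows "mat_adjoint A $$ (i, j) = cnj (A $$ (j, i))"
  using assms unfolding mat_adjoint_def by (simp add: mat_of_rows_def)

lemma mat_adjoint_dim [simp]:
  "dim_row (mat_adjoint A) = dim_col A" "dim_col (mat_adjoint A) = dim_row A"
  unfolding mat_adjoint_def by auto

lemma mult_index:
  assumes "A \<in> carrier_mat n m" "B \<in> carrier_mat m l" "i < n" "j < l"
  shows "(A * B) $$ (i, j) = (\<Sum>k<m. A $$ (i, k) * B $$ (k, j))"
  using assms by (auto simp: scalar_prod_def lessThan_atLeast0)

lemma mult_vec_index:
  assumes "A \<in> carrier_mat n m" "v \<in> carrier_vec m" "i < n"
  shows "(A *\<^sub>v v) $ i = (\<Sum>k<m. A $$ (i, k) * v $ k)"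
  using assms by (auto simp: scalar_prod_def lessThan_atLeast0)

lemma mat_adjoint_mult:
  fixes A B :: "complex mat"
  assumes "A \<in> carrier_mat n m" "B \<in> carrier_mat m l"
  shows "mat_adjoint (A * B) = mat_adjoint B * mat_adjoint A"
proof (rule eq_matI)
  fix i j assume "i < dim_row (mat_adjoint B * mat_adjoint A)" "j < dim_col (mat_adjoint B * mat_adjoint A)"
  then have ij: "i < l" "j < n" using assms by auto
  have "mat_adjoint (A * B) $$ (i, j) = cnj ((A * B) $$ (j, i))"
    using ij assms by auto
  also have "\<dots> = (\<Sum>k<m. mat_adjoint B $$ (i, k) * mat_adjoint A $$ (k, j))"
    unfolding mult_index[OF assms ij(2,1)] using ij assms by (simp add: mult.commute)
  also have "\<dots> = (mat_adjoint B * mat_adjoint A) $$ (i, j)"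
    by (rule mult_index[symmetric]) (use assms ij mat_adjoint_carrier in auto)
  finally show "mat_adjoint (A * B) $$ (i, j) = (mat_adjoint B * mat_adjoint A) $$ (i, j)" .
qed (use assms in auto)

lemma mat_adjoint_adjoint [simp]: "mat_adjoint (mat_adjoint A) = (A :: complex mat)"
  by (rule eq_matI) auto

lemma mat_trace_comm:
  assumes "A \<in> carrier_mat n m" "B \<in> carrier_mat m n"
  shows "mat_trace (A * B) = mat_trace (B * A)"
proof -
  have "mat_trace (A * B) = (\<Sum>i<n. \<Sum>k<m. A $$ (i, k) * B $$ (k, i))"
    unfolding mat_trace_def using assms by (auto simp: mult_index[OF assms] simp del: index_mult_mat(1))
  also have "\<dots> = (\<Sum>k<m. \<Sum>i<n. B $$ (k, i) * A $$ (i, k))"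
    by (subst sum.swap) (simp add: mult.commute)
  also have "\<dots> = mat_trace (B * A)"
    unfolding mat_trace_def using assms by (auto simp: mult_index[OF assms(2,1)] simp del: index_mult_mat(1))
  finally show ?thesis .
qed

lemma mat_trace_mat_diag: "mat_trace (mat_diag d f) = (\<Sum>i<d. f i)"
  unfolding mat_trace_def by (simp add: mat_diag_def)

lemma unitary_matD:
  assumes "unitary_mat d U"
  shows "U \<in> carrier_mat d d" "mat_adjoint U \<in> carrier_mat d d"
    "U * mat_adjoint U = 1\<^sub>m d" "mat_adjoint U * U = 1\<^sub>m d"
  using assms mat_adjoint_carrier[of U d d] unfolding unitary_mat_def by blast+

lemma unitary_matI:
  assumes "U \<in> carrier_mat d d" "mat_adjoint U * U = 1\<^sub>m d"
  shows "unitary_mat d U"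
  unfolding unitary_mat_def
  using assms mat_mult_left_right_inverse[OF mat_adjoint_carrier[OF assms(1)] assms] by blast

lemma unitary_mat_mult:
  assumes U: "unitary_mat d U" and V: "unitary_mat d V"
  shows "unitary_mat d (U * V)"
proof (rule unitary_matI)
  note u = unitary_matD[OF U] and v = unitary_matD[OF V]
  show "U * V \<in> carrier_mat d d" using u(1) v(1) by auto
  have "mat_adjoint (U * V) * (U * V) = mat_adjoint V * (mat_adjoint U * (U * V))"
    unfolding mat_adjoint_mult[OF u(1) v(1)] 
    by (rule assoc_mult_mat[OF v(2) u(2) mult_carrier_mat[OF u(1) v(1)]])
  also have "mat_adjoint U * (U * V) = V"
    by (simp add: assoc_mult_mat[OF u(2,1) v(1), symmetric] u(4) left_mult_one_mat[OF v(1)])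
  finally show "mat_adjoint (U * V) * (U * V) = 1\<^sub>m d" unfolding v(4) .
qed

lemma unitary_mat_one: "unitary_mat d (1\<^sub>m d)"
proof -
  have "mat_adjoint (1\<^sub>m d) = (1\<^sub>m d :: complex mat)"
    by (rule eq_matI) auto
  then show ?thesis unfolding unitary_mat_def by simp
qed

lemma unitary_mat_cols:
  assumes "unitary_mat d U" "i < d" "j < d"
  shows "(\<Sum>k<d. cnj (U $$ (k, i)) * U $$ (k, j)) = (if i = j then 1 else 0)"
proof -
  note u = unitary_matD[OF assms(1)]
  have "(\<Sum>k<d. cnj (U $$ (k, i)) * U $$ (k, j)) = (mat_adjoint U * U) $$ (i, j)"
    using assms u by (subst mult_index[OF u(2,1)]) auto
  then show ?thesis using u assms by simp
qed

text \<open>\<open>U\<close> need be neither unitary nor square. With a rectangular first factor the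
  same notion covers compressions, such as a diagonalised operator restricted to the columns of
  another matrix.\<close>

definition conj_diag :: "nat \<Rightarrow> complex mat \<Rightarrow> (nat \<Rightarrow> real) \<Rightarrow> complex mat" where
  "conj_diag d U l = U * mat_diag d (\<lambda>i. complex_of_real (l i)) * mat_adjoint U"

lemma conj_diag_carrier: "U \<in> carrier_mat n d \<Longrightarrow> conj_diag d U l \<in> carrier_mat n n"
  unfolding conj_diag_def by (auto intro!: mult_carrier_mat mat_adjoint_carrier)

lemma conj_diag_index:
  assumes "U \<in> carrier_mat n d" "i < n" "j < n"
  shows "conj_diag d U l $$ (i, j) = (\<Sum>k<d. U $$ (i, k) * l k * cnj (U $$ (j, k)))"
proof -
  have "conj_diag d U l $$ (i, j)
      = (\<Sum>k<d. (U * mat_diag d (\<lambda>i. complex_of_real (l i))) $$ (i, k) * mat_adjoint U $$ (k, j))"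
    unfolding conj_diag_def
    by (rule mult_index) (use assms in \<open>auto intro: mat_adjoint_carrier\<close>)
  also have "\<dots> = (\<Sum>k<d. U $$ (i, k) * l k * cnj (U $$ (j, k)))"
    using assms by (intro sum.cong) (auto simp: mat_diag_mult_right[OF assms(1)])
  finally show ?thesis .
qed

lemma conj_diag_adjoint:
  assumes "U \<in> carrier_mat n d"
  shows "mat_adjoint (conj_diag d U l) = conj_diag d U l"
proof (rule eq_matI)
  note c = conj_diag_carrier[OF assms, of l]
  show "dim_row (mat_adjoint (conj_diag d U l)) = dim_row (conj_diag d U l)"
    "dim_col (mat_adjoint (conj_diag d U l)) = dim_col (conj_diag d U l)"
    using c by auto
  fix i j assume "i < dim_row (conj_diag d U l)" "j < dim_col (conj_diag d U l)"
  then have ij: "i < n" "j < n" using c by auto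
  have "mat_adjoint (conj_diag d U l) $$ (i, j) = cnj (conj_diag d U l $$ (j, i))"
    using ij c by simp
  then show "mat_adjoint (conj_diag d U l) $$ (i, j) = conj_diag d U l $$ (i, j)"
    unfolding conj_diag_index[OF assms ij(1,2)] conj_diag_index[OF assms ij(2,1)] by (simp add: mult_ac)
qed

lemma conj_diag_minus:
  assumes "U \<in> carrier_mat n d"
  shows "conj_diag d U l - conj_diag d U m = conj_diag d U (\<lambda>i. l i - m i)"
proof (rule eq_matI)
  note c = conj_diag_carrier[OF assms]
  show "dim_row (conj_diag d U l - conj_diag d U m) = dim_row (conj_diag d U (\<lambda>i. l i - m i))"
    "dim_col (conj_diag d U l - conj_diag d U m) = dim_col (conj_diag d U (\<lambda>i. l i - m i))"
    using c[of m] c[of "\<lambda>i. l i - m i"] by auto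
  fix i j assume "i < dim_row (conj_diag d U (\<lambda>i. l i - m i))" "j < dim_col (conj_diag d U (\<lambda>i. l i - m i))"
  then have ij: "i < n" "j < n" using c[of "\<lambda>i. l i - m i"] by auto
  have "(conj_diag d U l - conj_diag d U m) $$ (i, j) = conj_diag d U l $$ (i, j) - conj_diag d U m $$ (i, j)"
    using ij c[of m] by simp
  then show "(conj_diag d U l - conj_diag d U m) $$ (i, j) = conj_diag d U (\<lambda>i. l i - m i) $$ (i, j)"
    unfolding conj_diag_index[OF assms ij] by (simp add: sum_subtractf[symmetric] algebra_simps)
qed

lemma conj_diag_mult:
  assumes "unitary_mat d U"
  shows "conj_diag d U l * conj_diag d U m = conj_diag d U (\<lambda>i. l i * m i)"
proof -
  note u = unitary_matD[OF assms]
  let ?D = "\<lambda>l. mat_diag d (\<lambda>i. complex_of_real (l i))"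
  note assoc = assoc_mult_mat[where n\<^sub>1 = d and n\<^sub>2 = d and n\<^sub>3 = d and n\<^sub>4 = d]
  note carr = u(1,2) mult_carrier_mat[where nr = d and n = d and nc = d]
  have "conj_diag d U l * conj_diag d U m
      = U * ?D l * (mat_adjoint U * U) * ?D m * mat_adjoint U"
    unfolding conj_diag_def by (simp only: assoc carr mat_diag_dim)
  also have "\<dots> = U * (?D l * ?D m) * mat_adjoint U"
    using carr by (simp add: u(4) assoc right_mult_one_mat[where nr = d and nc = d] del: mat_diag_diag)
  also have "?D l * ?D m = ?D (\<lambda>i. l i * m i)" by simp
  finally show ?thesis unfolding conj_diag_def .
qed

lemma conj_diag_trace:
  assumes "unitary_mat d U"
  shows "mat_trace (conj_diag d U l) = (\<Sum>i<d. complex_of_real (l i))"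
proof -
  note u = unitary_matD[OF assms]
  have "mat_trace (conj_diag d U l) = mat_trace (mat_adjoint U * (U * mat_diag d (\<lambda>i. complex_of_real (l i))))"
    unfolding conj_diag_def by (rule mat_trace_comm) (use u(1,2) in auto)
  also have "mat_adjoint U * (U * mat_diag d (\<lambda>i. complex_of_real (l i))) = mat_diag d (\<lambda>i. complex_of_real (l i))"
    by (simp add: assoc_mult_mat[OF u(2,1) mat_diag_dim, symmetric] u(4) left_mult_one_mat[OF mat_diag_dim])
  finally show ?thesis by (simp add: mat_trace_mat_diag)
qed

lemma hermitian_fun_conj_diag:
  assumes "unitary_mat d U"
  shows "hermitian_fun f (conj_diag d U l) = conj_diag d U (\<lambda>i. f (l i))"
  unfolding conj_diag_def by (rule hermitian_fun_eq[OF assms refl])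

text \<open>The square of the operator has eigenvalues \<open>l i * l i\<close> in the same basis,
  and \<open>sqrt\<close> turns them into absolute values. All trace norms below are evaluated this
  way.\<close>

lemma trace_norm_conj_diag:
  assumes "unitary_mat d U"
  shows "trace_norm (conj_diag d U l) = (\<Sum>i<d. \<bar>l i\<bar>)"
proof -
  have "mat_adjoint (conj_diag d U l) * conj_diag d U l = conj_diag d U (\<lambda>i. l i * l i)"
    unfolding conj_diag_adjoint[OF unitary_matD(1)[OF assms]] conj_diag_mult[OF assms] ..
  then show ?thesis
    unfolding trace_norm_def by (simp add: hermitian_fun_conj_diag[OF assms] conj_diag_trace[OF assms])
qed

lemma entropy_conj_diag:
  assumes "unitary_mat d U"
  shows "von_neumann_entropy (conj_diag d U l) = - (\<Sum>i<d. l i * log 2 (l i))"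
  unfolding von_neumann_entropy_def hermitian_fun_conj_diag[OF assms] conj_diag_mult[OF assms]
    conj_diag_trace[OF assms] by (simp only: of_real_sum[symmetric] Re_complex_of_real)

section \<open>Spectral theorem\<close>

lemma cscalar_prod_sum:
  assumes "v \<in> carrier_vec d" "w \<in> carrier_vec d"
  shows "v \<bullet>c w = (\<Sum>i<d. v $ i * cnj (w $ i))"
  using assms by (simp add: scalar_prod_def lessThan_atLeast0)

lemma mult_cnj_self: "z * cnj z = complex_of_real ((cmod z)\<^sup>2)" "cnj z * z = complex_of_real ((cmod z)\<^sup>2)"
  by (simp_all add: complex_norm_square[symmetric] mult.commute)

lemma conj_diag_conjugate:
  assumes U: "U \<in> carrier_mat n m" and V: "V \<in> carrier_mat m d"
  shows "U * conj_diag d V l * mat_adjoint U = conj_diag d (U * V) l"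
proof -
  let ?D = "mat_diag d (\<lambda>i. complex_of_real (l i))"
  note U' = mat_adjoint_carrier[OF U] and V' = mat_adjoint_carrier[OF V]
  have D: "?D \<in> carrier_mat d d" by (rule mat_diag_dim)
  have "U * (V * ?D * mat_adjoint V) = U * V * ?D * mat_adjoint V"
    by (simp only: assoc_mult_mat[OF U mult_carrier_mat[OF V D] V'] assoc_mult_mat[OF U V D])
  then show ?thesis
    unfolding conj_diag_def mat_adjoint_mult[OF U V]
    by (simp only: assoc_mult_mat[OF mult_carrier_mat[OF mult_carrier_mat[OF U V] D] V' U'])
qed

text \<open>This serves two purposes: completing an eigenvector to an orthonormal basis, and
  steering a pure input to a chosen purification. The phase \<open>z\<close> is harmless in both,
  since eigenvectors and rank-one projectors do not see it.\<close>

lemma householder_exists: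
  assumes a: "a \<in> carrier_vec d" "a \<bullet>c a = 1" and b: "b \<in> carrier_vec d" "b \<bullet>c b = 1"
  shows "\<exists>U z. unitary_mat d U \<and> cmod z = 1 \<and> U *\<^sub>v a = z \<cdot>\<^sub>v b"
proof -
  define s where "s = (\<Sum>i<d. a $ i * cnj (b $ i))"
  \<comment> \<open>The phase makes \<open>\<langle>z b, a\<rangle>\<close> real, so that the reflection along \<open>a - z b\<close> maps \<open>a\<close> to \<open>z b\<close>.\<close>
  define z where "z = (if s = 0 then 1 else sgn s)"
  have z: "cmod z = 1" unfolding z_def by (simp add: norm_sgn)
  have zz: "z * cnj z = 1" using z by (simp add: mult_cnj_self)
  define c where "c = cmod s"
  have "cnj z * s = c"
    unfolding c_def z_def
    by (auto simp: sgn_eq complex_norm_square[symmetric] power2_eq_square field_simps mult_cnj_self)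
  define y where "y i = z * b $ i" for i
  have ay: "(\<Sum>i<d. a $ i * cnj (y i)) = c"
    using \<open>cnj z * s = c\<close> unfolding s_def y_def by (simp add: sum_distrib_left mult_ac)
  have ya: "(\<Sum>i<d. y i * cnj (a $ i)) = c"
    using arg_cong[OF ay, of cnj] by (simp add: mult.commute)
  have ya': "(\<Sum>i<d. cnj (y i) * a $ i) = c"
    using ay by (simp add: mult.commute)
  have aa: "(\<Sum>i<d. a $ i * cnj (a $ i)) = 1"
    using a cscalar_prod_sum[OF a(1) a(1)] by simp
  have yy: "(\<Sum>i<d. y i * cnj (y i)) = 1"
  proof -
    have "(\<Sum>i<d. y i * cnj (y i)) = (z * cnj z) * (\<Sum>i<d. b $ i * cnj (b $ i))"
      unfolding y_def by (simp add: sum_distrib_left mult_ac)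
    then show ?thesis using b cscalar_prod_sum[OF b(1) b(1)] zz by simp
  qed
  define w where "w i = a $ i - y i" for i
  define n where "n = (\<Sum>i<d. w i * cnj (w i))"
  have n: "n = 2 * (1 - c)"
    unfolding n_def w_def by (simp add: algebra_simps sum.distrib sum_subtractf aa yy ay ya ya')
  show ?thesis
  \<comment> \<open>Here \<open>n\<close> is the squared length of the reflection direction
    \<open>w\<close>. If it vanishes, \<open>a\<close> already equals \<open>z\<close> times
    \<open>b\<close>, and the identity does the job.\<close>
  proof (cases "n = 0")
    case True
    have "(\<Sum>i<d. (cmod (w i))\<^sup>2) = 0"
    proof -
      have "complex_of_real (\<Sum>i<d. (cmod (w i))\<^sup>2) = n"
        unfolding n_def by (simp add: mult_cnj_self)
      then show ?thesis using True by (metis of_real_eq_0_iff)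
    qed
    then have "\<forall>i<d. w i = 0"
      by (subst (asm) sum_nonneg_eq_0_iff) auto
    then have "1\<^sub>m d *\<^sub>v a = z \<cdot>\<^sub>v b"
      using a b unfolding w_def y_def by (auto intro!: eq_vecI)
    then show ?thesis using z unitary_mat_one by blast
  next
    case False
    define U where "U = mat d d (\<lambda>(i, j). (if i = j then 1 else 0) - 2 / n * w i * cnj (w j))"
    have U: "U \<in> carrier_mat d d" unfolding U_def by simp
    have cn: "cnj n = n" unfolding n by simp
    have "mat_adjoint U * U = 1\<^sub>m d"
    proof (rule eq_matI)
      fix i j assume "i < dim_row (1\<^sub>m d)" "j < dim_col (1\<^sub>m d)"
      then have ij: "i < d" "j < d" by auto
      let ?\<delta> = "\<lambda>i j. if i = j then 1 else (0::complex)"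
      have "(mat_adjoint U * U) $$ (i, j) = (\<Sum>k<d. cnj (U $$ (k, i)) * U $$ (k, j))"
        using ij U by (subst mult_index[OF mat_adjoint_carrier[OF U] U]) auto
      also have "\<dots> = (\<Sum>k<d. ?\<delta> k i * ?\<delta> k j - ?\<delta> k i * (2 / n * w k * cnj (w j))
           - ?\<delta> k j * (2 / n * w i * cnj (w k)) + 4 / n\<^sup>2 * w i * cnj (w j) * (w k * cnj (w k)))"
        unfolding U_def using ij cn by (intro sum.cong) (auto simp: power2_eq_square algebra_simps)
      also have "\<dots> = ?\<delta> i j - 2 / n * w i * cnj (w j) - 2 / n * w i * cnj (w j)
            + 4 / n\<^sup>2 * w i * cnj (w j) * n"
      proof -
        have d: "(\<Sum>k<d. ?\<delta> k m * f k) = f m" if "m < d" for m and f :: "nat \<Rightarrow> complex"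
        proof -
          have "(\<Sum>k<d. ?\<delta> k m * f k) = (\<Sum>k<d. if k = m then f k else 0)" by (intro sum.cong) auto
          then show ?thesis using that by simp
        qed
        show ?thesis
          unfolding sum.distrib sum_subtractf d[OF ij(1)] d[OF ij(2)] n_def sum_distrib_left ..
      qed
      also have "\<dots> = 1\<^sub>m d $$ (i, j)"
        using False ij by (simp add: power2_eq_square field_simps)
      finally show "(mat_adjoint U * U) $$ (i, j) = 1\<^sub>m d $$ (i, j)" .
    qed (use U in auto)
    then have un: "unitary_mat d U" using U by (intro unitary_matI)
    \<comment> \<open>The coefficient is half the squared length of \<open>w\<close>, so the
      reflection subtracts exactly \<open>w\<close> from \<open>a\<close>. This uses that both mixed
      inner products equal the real number \<open>c\<close>.\<close>
    have wa: "(\<Sum>k<d. cnj (w k) * a $ k) = n / 2"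
      unfolding w_def n by (simp add: algebra_simps sum_subtractf aa ay ya')
    have "U *\<^sub>v a = z \<cdot>\<^sub>v b"
    proof (rule eq_vecI)
      fix i assume "i < dim_vec (z \<cdot>\<^sub>v b)"
      then have i: "i < d" using b by simp
      have "(U *\<^sub>v a) $ i = (\<Sum>k<d. (if k = i then a $ k else 0) - 2 / n * w i * (cnj (w k) * a $ k))"
        unfolding mult_vec_index[OF U a(1) i] using i
        by (intro sum.cong) (auto simp: U_def algebra_simps)
      also have "\<dots> = a $ i - 2 / n * w i * (n / 2)"
        unfolding sum_subtractf wa[symmetric] sum_distrib_left using i by simp
      also have "2 / n * w i * (n / 2) = w i" using False by simp
      also have "a $ i - w i = y i" unfolding w_def by simp
      finally show "(U *\<^sub>v a) $ i = (z \<cdot>\<^sub>v b) $ i" using i b unfolding y_def by simp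
    qed (use U b in auto)
    then show ?thesis using un z by blast
  qed
qed

text \<open>Over the complex numbers the spectrum of a matrix of positive size is nonempty; any
  eigenvector is then normalised.\<close>

lemma unit_eigenvector_exists:
  fixes A :: "complex mat"
  assumes A: "A \<in> carrier_mat n n" and "n > 0"
  shows "\<exists>v e. v \<in> carrier_vec n \<and> v \<bullet>c v = 1 \<and> A *\<^sub>v v = e \<cdot>\<^sub>v v"
proof -
  obtain e where "eigenvalue A e"
    using spectrum_non_empty[OF assms] unfolding spectrum_def by auto
  then obtain v where v: "v \<in> carrier_vec n" "v \<noteq> 0\<^sub>v n" "A *\<^sub>v v = e \<cdot>\<^sub>v v"
    using A unfolding eigenvalue_def eigenvector_def by auto
  define q where "q = (\<Sum>i<n. (cmod (v $ i))\<^sup>2)"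
  have "q > 0"
  proof -
    obtain i where "i < n" "v $ i \<noteq> 0" using v(1,2) by (metis carrier_vecD eq_vecI index_zero_vec)
    then have "0 < (cmod (v $ i))\<^sup>2" "(cmod (v $ i))\<^sup>2 \<le> q"
      unfolding q_def by (auto intro: member_le_sum)
    then show ?thesis by linarith
  qed
  define c where "c = complex_of_real (1 / sqrt q)"
  have "(c \<cdot>\<^sub>v v) \<bullet>c (c \<cdot>\<^sub>v v) = (\<Sum>i<n. (c * cnj c) * (v $ i * cnj (v $ i)))"
    using v(1) by (subst cscalar_prod_sum[of _ n]) (auto simp: mult_ac)
  also have "\<dots> = complex_of_real (1 / q) * complex_of_real q"
  proof -
    have "c * cnj c = complex_of_real (1 / q)"
      unfolding c_def using \<open>q > 0\<close> by (simp flip: of_real_mult)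
    moreover have "(\<Sum>i<n. v $ i * cnj (v $ i)) = complex_of_real q"
      unfolding q_def by (simp add: mult_cnj_self)
    ultimately show ?thesis by (simp only: sum_distrib_left[symmetric])
  qed
  also have "\<dots> = 1" using \<open>q > 0\<close> by simp
  finally have "(c \<cdot>\<^sub>v v) \<bullet>c (c \<cdot>\<^sub>v v) = 1" .
  moreover have "A *\<^sub>v (c \<cdot>\<^sub>v v) = e \<cdot>\<^sub>v (c \<cdot>\<^sub>v v)"
    using v A by (simp add: mult_mat_vec smult_smult_assoc mult.commute)
  ultimately show ?thesis using v(1) by (intro exI[of _ "c \<cdot>\<^sub>v v"] exI[of _ e]) auto
qed

text \<open>Induction by deflation: a unitary \<open>H\<close> carries the first basis vector to an
  eigenvector, so the first column of the conjugated matrix \<open>B\<close> is zero off the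
  diagonal. Self-adjointness clears the first row as well, and the induction hypothesis treats the
  remaining block \<open>B'\<close>.\<close>

lemma hermitian_diagonalization:
  assumes "A \<in> carrier_mat d d" "mat_adjoint A = A"
  shows "\<exists>U l. unitary_mat d U \<and> A = conj_diag d U l"
  using assms
proof (induction d arbitrary: A)
  case 0
  have "A = conj_diag 0 (1\<^sub>m 0) (\<lambda>_. 0)"
    using 0 carrier_matD[OF conj_diag_carrier[of "1\<^sub>m 0" 0 0 "\<lambda>_. 0"]] by (intro eq_matI) simp_all
  then show ?case using unitary_mat_one by blast
next
  case (Suc n)
  let ?d = "Suc n"
  obtain v e where v: "v \<in> carrier_vec ?d" "v \<bullet>c v = 1" "A *\<^sub>v v = e \<cdot>\<^sub>v v"
    using unit_eigenvector_exists[OF Suc.prems(1)] by auto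
  have u: "unit_vec ?d 0 \<in> carrier_vec ?d" "unit_vec ?d 0 \<bullet>c unit_vec ?d 0 = (1 :: complex)"
    by (simp_all add: cscalar_prod_sum[of _ ?d] unit_vec_def sum.lessThan_Suc_shift del: sum.lessThan_Suc)
  obtain H z where H: "unitary_mat ?d H" "cmod z = 1" "H *\<^sub>v unit_vec ?d 0 = z \<cdot>\<^sub>v v"
    using householder_exists[OF u v(1,2)] by blast
  note h = unitary_matD[OF H(1)]
  define B where "B = mat_adjoint H * A * H"
  have Bc: "B \<in> carrier_mat ?d ?d"
    unfolding B_def by (rule mult_carrier_mat[OF mult_carrier_mat[OF h(2) Suc.prems(1)] h(1)])
  have Bad: "mat_adjoint B = B"
    unfolding B_def mat_adjoint_mult[OF mult_carrier_mat[OF h(2) Suc.prems(1)] h(1)]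
      mat_adjoint_mult[OF h(2) Suc.prems(1)] mat_adjoint_adjoint Suc.prems(2)
    by (rule assoc_mult_mat[OF h(2) Suc.prems(1) h(1), symmetric])
  have AB: "A = H * B * mat_adjoint H"
  proof -
    have "H * B * mat_adjoint H = H * mat_adjoint H * A * (H * mat_adjoint H)"
      unfolding B_def using h(1,2) Suc.prems(1)
      by (simp only: assoc_mult_mat[where n\<^sub>1 = ?d and n\<^sub>2 = ?d and n\<^sub>3 = ?d and n\<^sub>4 = ?d]
          mult_carrier_mat[where nr = ?d and n = ?d and nc = ?d])
    then show ?thesis using Suc.prems(1) unfolding h(3) by simp
  qed
  have Bu: "B *\<^sub>v unit_vec ?d 0 = e \<cdot>\<^sub>v unit_vec ?d 0"
  proof -
    have "B *\<^sub>v unit_vec ?d 0 = mat_adjoint H *\<^sub>v (A *\<^sub>v (H *\<^sub>v unit_vec ?d 0))"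
      unfolding B_def assoc_mult_mat_vec[OF mult_carrier_mat[OF h(2) Suc.prems(1)] h(1) u(1)]
        assoc_mult_mat_vec[OF h(2) Suc.prems(1) mult_mat_vec_carrier[OF h(1) u(1)]] ..
    also have "A *\<^sub>v (H *\<^sub>v unit_vec ?d 0) = e \<cdot>\<^sub>v (H *\<^sub>v unit_vec ?d 0)"
      unfolding H(3) using v Suc.prems(1) by (simp add: mult_mat_vec smult_smult_assoc mult.commute)
    also have "mat_adjoint H *\<^sub>v (e \<cdot>\<^sub>v (H *\<^sub>v unit_vec ?d 0)) = e \<cdot>\<^sub>v (mat_adjoint H *\<^sub>v (H *\<^sub>v unit_vec ?d 0))"
      by (rule mult_mat_vec[OF h(2)]) (use h(1) in auto)
    also have "mat_adjoint H *\<^sub>v (H *\<^sub>v unit_vec ?d 0) = unit_vec ?d 0"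
      using assoc_mult_mat_vec[OF h(2,1) u(1)] unfolding h(4) by simp
    finally show ?thesis .
  qed
  have col0: "B $$ (i, 0) = (if i = 0 then e else 0)" if "i < ?d" for i
  proof -
    have "(B *\<^sub>v unit_vec ?d 0) $ i = B $$ (i, 0)"
      unfolding mult_vec_index[OF Bc u(1) that]
      by (simp add: unit_vec_def sum.lessThan_Suc_shift del: sum.lessThan_Suc)
    then show ?thesis unfolding Bu using that by (simp add: unit_vec_def split: if_splits)
  qed
  have sym: "B $$ (i, j) = cnj (B $$ (j, i))" if "i < ?d" "j < ?d" for i j
    using mat_adjoint_index[of i B j] that carrier_matD[OF Bc] unfolding Bad by simp
  \<comment> \<open>The eigenvalue is a diagonal entry of the self-adjoint \<open>B\<close>, hence
    real, as the real list \<open>l\<close> of \<open>conj_diag\<close> demands.\<close>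
  obtain r where e: "e = complex_of_real r"
    using sym[of 0 0] col0[of 0] by (metis Reals_cases Reals_cnj_iff zero_less_Suc)
  have row0: "B $$ (0, i) = (if i = 0 then e else 0)" if "i < ?d" for i
  proof (cases "i = 0")
    case False
    then show ?thesis using sym[of 0 i] col0[OF that] that by simp
  qed (simp add: col0)
  define B' where "B' = mat n n (\<lambda>(i, j). B $$ (Suc i, Suc j))"
  have "mat_adjoint B' = B'"
    unfolding B'_def by (rule eq_matI) (auto simp: sym[symmetric])
  moreover have "B' \<in> carrier_mat n n" unfolding B'_def by simp
  ultimately obtain U' l' where U': "unitary_mat n U'" "B' = conj_diag n U' l'"
    using Suc.IH by blast
  note u' = unitary_matD[OF U'(1)]
  \<comment> \<open>The block sum of the 1 by 1 identity with \<open>U'\<close>.\<close>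
  define W where "W = mat ?d ?d (\<lambda>(i, j). if i = 0 \<and> j = 0 then 1
    else if i = 0 \<or> j = 0 then 0 else U' $$ (i - 1, j - 1))"
  define l where "l i = (if i = 0 then r else l' (i - 1))" for i
  have W: "W \<in> carrier_mat ?d ?d" unfolding W_def by simp
  have W_simps: "W $$ (0, 0) = 1" "i < n \<Longrightarrow> W $$ (Suc i, 0) = 0" "i < n \<Longrightarrow> W $$ (0, Suc i) = 0"
    "i < n \<Longrightarrow> j < n \<Longrightarrow> W $$ (Suc i, Suc j) = U' $$ (i, j)" for i j
    unfolding W_def by auto
  have "unitary_mat ?d W"
  proof (rule unitary_matI[OF W], rule eq_matI)
    fix i j assume "i < dim_row (1\<^sub>m ?d)" "j < dim_col (1\<^sub>m ?d)"
    then have ij: "i < ?d" "j < ?d" by auto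
    have "(mat_adjoint W * W) $$ (i, j) = (\<Sum>k<?d. cnj (W $$ (k, i)) * W $$ (k, j))"
      using ij W by (subst mult_index[OF mat_adjoint_carrier[OF W] W]) auto
    also have "\<dots> = 1\<^sub>m ?d $$ (i, j)"
      using ij unitary_mat_cols[OF U'(1)]
      by (cases i; cases j) (auto simp: sum.lessThan_Suc_shift W_simps simp del: sum.lessThan_Suc)
    finally show "(mat_adjoint W * W) $$ (i, j) = 1\<^sub>m ?d $$ (i, j)" .
  qed (use W in auto)
  moreover have "B = conj_diag ?d W l"
  proof (rule eq_matI)
    note c = conj_diag_carrier[OF W, of l]
    fix i j assume "i < dim_row (conj_diag ?d W l)" "j < dim_col (conj_diag ?d W l)"
    then have ij: "i < ?d" "j < ?d" using c by auto
    have B': "(\<Sum>k<n. U' $$ (i, k) * l' k * cnj (U' $$ (j, k))) = B $$ (Suc i, Suc j)" if "i < n" "j < n" for i j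
      using arg_cong[OF U'(2), of "\<lambda>M. M $$ (i, j)"] that unfolding conj_diag_index[OF u'(1) that]
      by (simp add: B'_def)
    show "B $$ (i, j) = conj_diag ?d W l $$ (i, j)"
      unfolding conj_diag_index[OF W ij] sum.lessThan_Suc_shift
      using ij by (cases i; cases j) (simp_all add: W_simps l_def col0 row0 e B')
  qed (use Bc conj_diag_carrier[OF W, of l] in auto)
  ultimately have W': "unitary_mat ?d W" and BW: "B = conj_diag ?d W l" by auto
  note w = unitary_matD[OF W']
  have "A = conj_diag ?d (H * W) l"
    using AB unfolding BW conj_diag_conjugate[OF h(1) w(1)] .
  then show ?case using unitary_mat_mult[OF H(1) W'] by blast
qed

section \<open>Distance of a low-rank state from a diagonal one\<close>

text \<open>Bessel's inequality for the unit vector with index \<open>i\<close> and the orthonormal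
  family obtained by dividing row \<open>c\<close> by the square root of \<open>t c\<close>.
  Restricting to \<open>C\<close> leaves out zero rows.\<close>

lemma orthogonal_rows_bessel:
  fixes r d :: nat and t :: "nat \<Rightarrow> real"
  assumes M: "\<And>c c'. c < r \<Longrightarrow> c' < r \<Longrightarrow>
      (\<Sum>k<d. M c k * cnj (M c' k)) = (if c = c' then complex_of_real (t c) else 0)"
    and C: "C \<subseteq> {..<r}" "\<And>c. c \<in> C \<Longrightarrow> t c > 0" and i: "i < d"
  shows "(\<Sum>c\<in>C. (cmod (M c i))\<^sup>2 / t c) \<le> 1"
proof -
  \<comment> \<open>\<open>K\<close> is row \<open>i\<close> of a projection, hence \<open>K i = \<parallel>K\<parallel>\<^sup>2 \<ge> (K i)\<^sup>2\<close>.\<close>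
  define K where "K j = (\<Sum>c\<in>C. cnj (M c i) * M c j / t c)" for j
  define b where "b = (\<Sum>c\<in>C. (cmod (M c i))\<^sup>2 / t c)"
  have fin: "finite C" using C(1) finite_subset by blast
  have Ki: "K i = b"
    unfolding K_def b_def by (simp add: mult_cnj_self)
  have "(\<Sum>j<d. K j * cnj (K j))
      = (\<Sum>j<d. \<Sum>c\<in>C. \<Sum>c'\<in>C. cnj (M c i) * M c' i / (t c * t c') * (M c j * cnj (M c' j)))"
    unfolding K_def cnj_sum sum_product by (intro sum.cong refl) (simp add: mult_ac)
  also have "\<dots> = (\<Sum>c\<in>C. \<Sum>c'\<in>C. \<Sum>j<d. cnj (M c i) * M c' i / (t c * t c') * (M c j * cnj (M c' j)))"
    by (subst sum.swap, rule sum.cong[OF refl], rule sum.swap)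
  also have "\<dots> = (\<Sum>c\<in>C. \<Sum>c'\<in>C. if c' = c then cnj (M c i) * M c i / t c else 0)"
  proof (intro sum.cong refl)
    fix c c' assume c: "c \<in> C" "c' \<in> C"
    then have c': "c < r" "c' < r" "t c > 0" using C by auto
    show "(\<Sum>j<d. cnj (M c i) * M c' i / (t c * t c') * (M c j * cnj (M c' j)))
        = (if c' = c then cnj (M c i) * M c i / t c else 0)"
      unfolding sum_distrib_left[symmetric] M[OF c'(1,2)] using c'(3) by auto
  qed
  also have "\<dots> = K i"
    unfolding K_def using fin by simp
  finally have "complex_of_real (\<Sum>j<d. (cmod (K j))\<^sup>2) = complex_of_real b"
    unfolding Ki by (simp add: mult_cnj_self)
  then have "(\<Sum>j<d. (cmod (K j))\<^sup>2) = b" by (simp only: of_real_eq_iff)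
  moreover have "(cmod (K i))\<^sup>2 \<le> (\<Sum>j<d. (cmod (K j))\<^sup>2)"
    using i by (intro member_le_sum) auto
  ultimately have "b * b \<le> 1 * b" unfolding Ki by (simp add: power2_eq_square)
  moreover have "b \<ge> 0" unfolding b_def using C(2) by (intro sum_nonneg) (simp add: less_imp_le)
  ultimately have "b \<le> 1" using mult_right_le_imp_le[of b b 1] by (cases "b = 0") auto
  then show ?thesis unfolding b_def .
qed

text \<open>The columns of \<open>W\<close> with index in \<open>C\<close>, divided by their norms,
  are orthonormal; let P project onto their span. The left-hand sum is the trace of P times the
  diagonalised operator, and \<open>b i\<close> is the quadratic form of P at column
  \<open>i\<close> of \<open>U\<close>. Hence the bounds by 0 and 1, and the total is the rank of
  P.\<close>

lemma weighted_quadratic_forms: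
  assumes W: "W \<in> carrier_mat d r" and WW: "mat_adjoint W * W = mat_diag r (\<lambda>c. complex_of_real (t c))"
    and C: "C \<subseteq> {..<r}" "\<And>c. c \<in> C \<Longrightarrow> t c > 0" and U: "unitary_mat d U"
  shows "\<exists>b. (\<forall>i<d. 0 \<le> b i \<and> b i \<le> 1) \<and> (\<Sum>i<d. b i) = real (card C) \<and>
    (\<forall>s. (\<Sum>c\<in>C. Re ((mat_adjoint W * conj_diag d U s * W) $$ (c, c)) / t c) = (\<Sum>i<d. s i * b i))"
proof -
  note u = unitary_matD[OF U] and W' = mat_adjoint_carrier[OF W]
  \<comment> \<open>Entry (c, i) is the inner product of column \<open>c\<close> of \<open>W\<close>
    with column \<open>i\<close> of \<open>U\<close>. As \<open>U\<close> is unitary, the rows of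
    \<open>M\<close> inherit the orthogonality and norms of the columns of \<open>W\<close>.\<close>
  define M where "M = mat_adjoint W * U"
  have Mc: "M \<in> carrier_mat r d" unfolding M_def by (rule mult_carrier_mat[OF W' u(1)])
  have "M * mat_adjoint M = mat_adjoint W * (U * (mat_adjoint U * W))"
    unfolding M_def mat_adjoint_mult[OF W' u(1)] mat_adjoint_adjoint
    by (rule assoc_mult_mat[OF W' u(1) mult_carrier_mat[OF u(2) W]])
  also have "U * (mat_adjoint U * W) = W"
    by (simp only: assoc_mult_mat[OF u(1,2) W, symmetric] u(3) left_mult_one_mat[OF W])
  finally have MM: "M * mat_adjoint M = mat_diag r (\<lambda>c. complex_of_real (t c))" unfolding WW .
  have orth: "(\<Sum>k<d. M $$ (c, k) * cnj (M $$ (c', k))) = (if c = c' then complex_of_real (t c) else 0)"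
    if "c < r" "c' < r" for c c'
  proof -
    have "(\<Sum>k<d. M $$ (c, k) * cnj (M $$ (c', k))) = (M * mat_adjoint M) $$ (c, c')"
      using that Mc by (subst mult_index[OF Mc mat_adjoint_carrier[OF Mc]]) auto
    then show ?thesis unfolding MM using that by (simp add: mat_diag_def)
  qed
  define b where "b i = (\<Sum>c\<in>C. (cmod (M $$ (c, i)))\<^sup>2 / t c)" for i
  have "b i \<le> 1" if "i < d" for i
    unfolding b_def using orthogonal_rows_bessel[where M = "\<lambda>c k. M $$ (c, k)" and t = t, OF orth C that] by simp
  moreover have "0 \<le> b i" for i
    unfolding b_def using C(2) by (intro sum_nonneg) (simp add: less_imp_le)
  moreover have "(\<Sum>i<d. b i) = real (card C)"
  proof -
    have "(\<Sum>i<d. (cmod (M $$ (c, i)))\<^sup>2) = t c" if "c \<in> C" for c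
    proof -
      have "complex_of_real (\<Sum>i<d. (cmod (M $$ (c, i)))\<^sup>2) = complex_of_real (t c)"
        using orth[of c c] C(1) that by (simp add: mult_cnj_self subset_iff)
      then show ?thesis by (simp only: of_real_eq_iff)
    qed
    then have "(\<Sum>i<d. b i) = (\<Sum>c\<in>C. t c / t c)"
      unfolding b_def by (subst sum.swap) (simp add: sum_divide_distrib[symmetric])
    also have "\<dots> = (\<Sum>c\<in>C. 1)" using C(2) by (intro sum.cong) force+
    finally show ?thesis by simp
  qed
  moreover have "(\<Sum>c\<in>C. Re ((mat_adjoint W * conj_diag d U s * W) $$ (c, c)) / t c) = (\<Sum>i<d. s i * b i)" for s
  proof -
    have "mat_adjoint W * conj_diag d U s * W = conj_diag d M s"
      using conj_diag_conjugate[OF W' u(1)] unfolding M_def mat_adjoint_adjoint .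
    then have "Re ((mat_adjoint W * conj_diag d U s * W) $$ (c, c)) = (\<Sum>i<d. s i * (cmod (M $$ (c, i)))\<^sup>2)"
      if "c \<in> C" for c
    proof -
      have "c < r" using that C(1) by auto
      from conj_diag_index[OF Mc this this]
      have "conj_diag d M s $$ (c, c) = (\<Sum>i<d. M $$ (c, i) * s i * cnj (M $$ (c, i)))" .
      also have "\<dots> = (\<Sum>i<d. complex_of_real (s i * (cmod (M $$ (c, i)))\<^sup>2))"
        unfolding of_real_mult mult_cnj_self(1)[symmetric] by (intro sum.cong) (simp_all only: mult_ac)
      also have "\<dots> = complex_of_real (\<Sum>i<d. s i * (cmod (M $$ (c, i)))\<^sup>2)" by (rule of_real_sum[symmetric])
      finally show ?thesis
        using \<open>mat_adjoint W * conj_diag d U s * W = conj_diag d M s\<close> Re_complex_of_real by metis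
    qed
    then show ?thesis
      unfolding b_def sum_distrib_left by (subst sum.swap) (simp add: sum_divide_distrib)
  qed
  ultimately show ?thesis by blast
qed

text \<open>Multiplying \<open>V\<close> on the right by a unitary leaves
  \<open>V * mat_adjoint V\<close> unchanged; the eigenbasis of \<open>mat_adjoint V * V\<close>
  makes the columns orthogonal. This is half of a singular value decomposition: the nonzero columns
  are eigenvectors of the state, and \<open>t c\<close> is both eigenvalue and squared norm.\<close>

lemma orthogonal_columns_exist:
  assumes V: "V \<in> carrier_mat d r"
  shows "\<exists>W t. W \<in> carrier_mat d r \<and> W * mat_adjoint W = V * mat_adjoint V \<and>
    mat_adjoint W * W = mat_diag r (\<lambda>c. complex_of_real (t c)) \<and> (\<forall>c<r. t c \<ge> 0)"
proof -
  note V' = mat_adjoint_carrier[OF V]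
  have "mat_adjoint (mat_adjoint V * V) = mat_adjoint V * V"
    unfolding mat_adjoint_mult[OF V' V] mat_adjoint_adjoint ..
  then obtain Y t where Y: "unitary_mat r Y" and t: "mat_adjoint V * V = conj_diag r Y t"
    using hermitian_diagonalization[OF mult_carrier_mat[OF V' V]] by blast
  note y = unitary_matD[OF Y]
  let ?D = "mat_diag r (\<lambda>c. complex_of_real (t c))"
  have D: "?D \<in> carrier_mat r r" by (rule mat_diag_dim)
  define W where "W = V * Y"
  have W: "W \<in> carrier_mat d r" unfolding W_def by (rule mult_carrier_mat[OF V y(1)])
  have "W * mat_adjoint W = V * (Y * (mat_adjoint Y * mat_adjoint V))"
    unfolding W_def mat_adjoint_mult[OF V y(1)]
    by (rule assoc_mult_mat[OF V y(1) mult_carrier_mat[OF y(2) V']])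
  also have "Y * (mat_adjoint Y * mat_adjoint V) = mat_adjoint V"
    by (simp only: assoc_mult_mat[OF y(1,2) V', symmetric] y(3) left_mult_one_mat[OF V'])
  finally have WW: "W * mat_adjoint W = V * mat_adjoint V" .
  have "mat_adjoint W * W = mat_adjoint Y * (mat_adjoint V * V) * Y"
    unfolding W_def mat_adjoint_mult[OF V y(1)]
    by (simp only: assoc_mult_mat[OF y(2) V' mult_carrier_mat[OF V y(1)]] assoc_mult_mat[OF V' V y(1)]
        assoc_mult_mat[OF y(2) mult_carrier_mat[OF V' V] y(1)])
  also have "\<dots> = conj_diag r (mat_adjoint Y * Y) t"
    unfolding t using conj_diag_conjugate[OF y(2,1)] by simp
  also have "\<dots> = ?D"
  proof -
    have "mat_adjoint (1\<^sub>m r) = (1\<^sub>m r :: complex mat)" by (rule eq_matI) auto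
    then show ?thesis
      unfolding y(4) conj_diag_def by (simp add: left_mult_one_mat[OF D] right_mult_one_mat[OF D])
  qed
  finally have WD: "mat_adjoint W * W = ?D" .
  have "t c \<ge> 0" if "c < r" for c
  proof -
    have "complex_of_real (t c) = (mat_adjoint W * W) $$ (c, c)"
      unfolding WD using that by (simp add: mat_diag_def)
    also have "\<dots> = (\<Sum>k<d. cnj (W $$ (k, c)) * W $$ (k, c))"
      using that W by (subst mult_index[OF mat_adjoint_carrier[OF W] W]) auto
    also have "\<dots> = complex_of_real (\<Sum>k<d. (cmod (W $$ (k, c)))\<^sup>2)"
      by (simp add: mult_cnj_self)
    finally have "t c = (\<Sum>k<d. (cmod (W $$ (k, c)))\<^sup>2)" by (simp only: of_real_eq_iff)
    then show ?thesis by (simp add: sum_nonneg)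
  qed
  then show ?thesis using W WW WD by blast
qed

text \<open>Let P project onto the support of \<sigma> and let \<tau> be the diagonal operator. Then
  1 = Tr P\<sigma> = Tr P(\<sigma> - \<tau>) + Tr P\<tau>. The first term is at most the trace norm
  because P lies between 0 and 1; the second splits into eigenvalues above and below
  \<theta>.\<close>

lemma low_rank_trace_norm_bound:
  assumes V: "V \<in> carrier_mat d r" and \<sigma>: "\<sigma> = V * mat_adjoint V" "mat_trace \<sigma> = 1"
    and U: "unitary_mat d U" and p: "\<And>i. i < d \<Longrightarrow> 0 \<le> p i" and "\<theta> \<ge> 0"
  shows "1 \<le> trace_norm (\<sigma> - conj_diag d U p) + (\<Sum>i | i < d \<and> p i > \<theta>. p i) + \<theta> * r"
proof -
  obtain W t where W: "W \<in> carrier_mat d r" "W * mat_adjoint W = \<sigma>"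
      "mat_adjoint W * W = mat_diag r (\<lambda>c. complex_of_real (t c))" and t: "\<forall>c<r. t c \<ge> 0"
    using orthogonal_columns_exist[OF V] unfolding \<sigma>(1) by auto
  note W' = mat_adjoint_carrier[OF W(1)] and u = unitary_matD[OF U]
  define \<tau> where "\<tau> = conj_diag d U p"
  have \<tau>: "\<tau> \<in> carrier_mat d d" "mat_adjoint \<tau> = \<tau>"
    unfolding \<tau>_def by (rule conj_diag_carrier[OF u(1)], rule conj_diag_adjoint[OF u(1)])
  have \<sigma>c: "\<sigma> \<in> carrier_mat d d" unfolding \<sigma> by (rule mult_carrier_mat[OF V mat_adjoint_carrier[OF V]])
  have \<sigma>h: "mat_adjoint \<sigma> = \<sigma>"
    unfolding \<sigma>(1) mat_adjoint_mult[OF V mat_adjoint_carrier[OF V]] mat_adjoint_adjoint ..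
  have Ac: "\<sigma> - \<tau> \<in> carrier_mat d d" by (rule minus_carrier_mat[OF \<tau>(1)])
  have "mat_adjoint (\<sigma> - \<tau>) = mat_adjoint \<sigma> - mat_adjoint \<tau>"
    by (rule eq_matI) (use \<sigma>c \<tau>(1) in auto)
  then obtain X s where X: "unitary_mat d X" and s: "\<sigma> - \<tau> = conj_diag d X s"
    using hermitian_diagonalization[OF Ac] unfolding \<sigma>h \<tau>(2) by blast
  define C where "C = {c. c < r \<and> t c > 0}"
  have C: "C \<subseteq> {..<r}" "\<And>c. c \<in> C \<Longrightarrow> t c > 0" unfolding C_def by auto
  \<comment> \<open>\<open>Q B\<close> is the trace of \<open>B\<close> against the projector onto the support of \<open>\<sigma>\<close>.\<close>
  define Q where "Q B = (\<Sum>c\<in>C. Re ((mat_adjoint W * B * W) $$ (c, c)) / t c)" for B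
  obtain b where b: "\<forall>i<d. 0 \<le> b i \<and> b i \<le> 1" and bQ: "\<And>s. Q (conj_diag d X s) = (\<Sum>i<d. s i * b i)"
    using weighted_quadratic_forms[OF W(1,3) C X] unfolding Q_def by blast
  obtain b' where b': "\<forall>i<d. 0 \<le> b' i \<and> b' i \<le> 1" "(\<Sum>i<d. b' i) = real (card C)"
      and bQ': "\<And>s. Q (conj_diag d U s) = (\<Sum>i<d. s i * b' i)"
    using weighted_quadratic_forms[OF W(1,3) C U] unfolding Q_def by blast
  \<comment> \<open>The columns of \<open>W\<close> are eigenvectors of \<sigma>, so testing against
    its support projector returns the sum of its nonzero eigenvalues, which is its trace.\<close>
  have "Q \<sigma> = (\<Sum>c\<in>C. t c)"
    unfolding Q_def
  proof (intro sum.cong refl)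
    fix c assume c: "c \<in> C"
    have "mat_adjoint W * \<sigma> * W = (mat_adjoint W * W) * (mat_adjoint W * W)"
      unfolding W(2)[symmetric]
      by (simp only: assoc_mult_mat[OF W' W(1) W', symmetric]
          assoc_mult_mat[OF mult_carrier_mat[OF W' W(1)] W' W(1)])
    also have "\<dots> = mat_diag r (\<lambda>c. complex_of_real (t c * t c))" unfolding W(3) by simp
    finally have "Re ((mat_adjoint W * \<sigma> * W) $$ (c, c)) = t c * t c"
      using c C(1) by (auto simp: mat_diag_def)
    then show "Re ((mat_adjoint W * \<sigma> * W) $$ (c, c)) / t c = t c" using C(2)[OF c] by simp
  qed
  also have "\<dots> = (\<Sum>c<r. t c)"
    by (rule sum.mono_neutral_left) (use t in \<open>force simp: C_def\<close>)+
  also have "\<dots> = 1"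
  proof -
    have "complex_of_real (\<Sum>c<r. t c) = mat_trace (mat_adjoint W * W)"
      unfolding W(3) mat_trace_mat_diag by simp
    also have "\<dots> = mat_trace \<sigma>" unfolding W(2)[symmetric] by (rule mat_trace_comm[OF W' W(1)])
    finally have "complex_of_real (\<Sum>c<r. t c) = complex_of_real 1" unfolding \<sigma>(2) by simp
    then show ?thesis by (simp only: of_real_eq_iff)
  qed
  finally have "Q \<sigma> = 1" .
  moreover have "Q (\<sigma> - \<tau>) = Q \<sigma> - Q \<tau>"
    unfolding Q_def sum_subtractf[symmetric]
  proof (intro sum.cong refl)
    fix c assume "c \<in> C"
    then have c: "c < r" using C(1) by auto
    have "mat_adjoint W * (\<sigma> - \<tau>) * W = mat_adjoint W * \<sigma> * W - mat_adjoint W * \<tau> * W"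
      unfolding mult_minus_distrib_mat[OF W' \<sigma>c \<tau>(1)]
      by (rule minus_mult_distrib_mat[OF mult_carrier_mat[OF W' \<sigma>c] mult_carrier_mat[OF W' \<tau>(1)] W(1)])
    moreover have "mat_adjoint W * \<tau> * W \<in> carrier_mat r r"
      by (rule mult_carrier_mat[OF mult_carrier_mat[OF W' \<tau>(1)] W(1)])
    ultimately have "(mat_adjoint W * (\<sigma> - \<tau>) * W) $$ (c, c)
        = (mat_adjoint W * \<sigma> * W) $$ (c, c) - (mat_adjoint W * \<tau> * W) $$ (c, c)"
      using c by (metis carrier_matD index_minus_mat(1))
    then show "Re ((mat_adjoint W * (\<sigma> - \<tau>) * W) $$ (c, c)) / t c =
        Re ((mat_adjoint W * \<sigma> * W) $$ (c, c)) / t c - Re ((mat_adjoint W * \<tau> * W) $$ (c, c)) / t c"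
      by (simp add: diff_divide_distrib)
  qed
  moreover have "Q (\<sigma> - \<tau>) \<le> trace_norm (\<sigma> - \<tau>)"
    unfolding s bQ trace_norm_conj_diag[OF X]
  proof (rule sum_mono)
    fix i assume "i \<in> {..<d}"
    then have "0 \<le> b i" "b i \<le> 1" using b by auto
    then show "s i * b i \<le> \<bar>s i\<bar>"
      by (metis abs_ge_self abs_ge_zero mult_left_le mult_right_mono order_trans)
  qed
  moreover have "Q \<tau> \<le> (\<Sum>i | i < d \<and> p i > \<theta>. p i) + \<theta> * r"
  proof -
    \<comment> \<open>Eigenvalues above \<theta> use \<open>b' i \<le> 1\<close>; for the others
      \<open>p i\<close> is replaced by \<theta>, and the sum of \<open>b'\<close> then produces the
      rank.\<close>
    have "Q \<tau> \<le> (\<Sum>i<d. (if p i > \<theta> then p i else 0) + \<theta> * b' i)"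
      unfolding \<tau>_def bQ'
    proof (rule sum_mono)
      fix i assume "i \<in> {..<d}"
      then have i: "0 \<le> b' i" "b' i \<le> 1" "0 \<le> p i" using b' p by auto
      show "p i * b' i \<le> (if p i > \<theta> then p i else 0) + \<theta> * b' i"
      proof (cases "p i > \<theta>")
        case True
        have "p i * b' i \<le> p i" using i by (simp add: mult_left_le)
        moreover have "0 \<le> \<theta> * b' i" using i \<open>\<theta> \<ge> 0\<close> by simp
        ultimately show ?thesis using True by simp
      next
        case False
        then show ?thesis using i by (simp add: mult_right_mono)
      qed
    qed
    also have "\<dots> = (\<Sum>i | i < d \<and> p i > \<theta>. p i) + \<theta> * card C"
      unfolding sum.distrib sum_distrib_left[symmetric] b'(2)
      by (simp add: sum.If_cases Int_def)
    also have "real (card C) \<le> r"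
      using card_mono[OF _ C(1)] by simp
    then have "(\<Sum>i | i < d \<and> p i > \<theta>. p i) + \<theta> * card C \<le> (\<Sum>i | i < d \<and> p i > \<theta>. p i) + \<theta> * r"
      using \<open>\<theta> \<ge> 0\<close> by (simp add: mult_left_mono)
    finally show ?thesis .
  qed
  ultimately show ?thesis unfolding \<tau>_def by linarith
qed

section \<open>Noiseless operations\<close>

lemma sum_lessThan_mult:
  fixes f :: "nat \<Rightarrow> 'a :: comm_monoid_add"
  shows "(\<Sum>x<m * n. f x) = (\<Sum>i<m. \<Sum>j<n. f (i * n + j))"
proof -
  have "(\<Sum>x<m * n. f x) = (\<Sum>i<m. sum f {i * n..<i * n + n})"
    by (rule sum.nat_group[symmetric])
  also have "\<dots> = (\<Sum>i<m. \<Sum>j<n. f (i * n + j))"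
  proof (rule sum.cong[OF refl])
    fix i
    show "sum f {i * n..<i * n + n} = (\<Sum>j<n. f (i * n + j))"
      using sum.shift_bounds_nat_ivl[of f 0 "i * n" n] by (simp add: lessThan_atLeast0 add.commute)
  qed
  finally show ?thesis .
qed

section \<open>Rank-one projectors and pure product inputs\<close>

lemma outer_prod_index:
  assumes "v \<in> carrier_vec n" "w \<in> carrier_vec m" "i < n" "j < m"
  shows "outer_prod v w $$ (i, j) = v $ i * cnj (w $ j)"
  using assms unfolding outer_prod_def by simp

lemma outer_prod_carrier: "v \<in> carrier_vec n \<Longrightarrow> w \<in> carrier_vec m \<Longrightarrow> outer_prod v w \<in> carrier_mat n m"
  unfolding outer_prod_def by auto

text \<open>Starting point for tracking factors: a pure state has a factor with a single
  column.\<close>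

lemma outer_prod_factor:
  assumes "v \<in> carrier_vec n"
  shows "\<exists>V \<in> carrier_mat n 1. outer_prod v v = V * mat_adjoint V"
proof
  let ?V = "mat n 1 (\<lambda>(i, j). v $ i)"
  show V: "?V \<in> carrier_mat n 1" by simp
  show "outer_prod v v = ?V * mat_adjoint ?V"
  proof (rule eq_matI)
    fix i j assume "i < dim_row (?V * mat_adjoint ?V)" "j < dim_col (?V * mat_adjoint ?V)"
    then have ij: "i < n" "j < n" by auto
    show "outer_prod v v $$ (i, j) = (?V * mat_adjoint ?V) $$ (i, j)"
      unfolding mult_index[OF V mat_adjoint_carrier[OF V] ij] outer_prod_index[OF assms assms ij]
      using ij by simp
  qed (use assms in \<open>auto simp: outer_prod_def\<close>)
qed

lemma outer_prod_trace:
  assumes "v \<in> carrier_vec n"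
  shows "mat_trace (outer_prod v v) = v \<bullet>c v"
  using assms unfolding mat_trace_def cscalar_prod_sum[OF assms assms] outer_prod_def by simp

lemma outer_prod_conjugate:
  assumes U: "U \<in> carrier_mat n m" and v: "v \<in> carrier_vec m"
  shows "U * outer_prod v v * mat_adjoint U = outer_prod (U *\<^sub>v v) (U *\<^sub>v v)"
proof (rule eq_matI)
  have Uv: "U *\<^sub>v v \<in> carrier_vec n" using U v by simp
  note o = outer_prod_carrier[OF v v] and Uo = mult_carrier_mat[OF U outer_prod_carrier[OF v v]]
  show "dim_row (U * outer_prod v v * mat_adjoint U) = dim_row (outer_prod (U *\<^sub>v v) (U *\<^sub>v v))"
    "dim_col (U * outer_prod v v * mat_adjoint U) = dim_col (outer_prod (U *\<^sub>v v) (U *\<^sub>v v))"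
    using U unfolding outer_prod_def by auto
  fix i j assume "i < dim_row (outer_prod (U *\<^sub>v v) (U *\<^sub>v v))" "j < dim_col (outer_prod (U *\<^sub>v v) (U *\<^sub>v v))"
  then have ij: "i < n" "j < n" using carrier_matD[OF outer_prod_carrier[OF Uv Uv]] by auto
  have "(U * outer_prod v v * mat_adjoint U) $$ (i, j)
      = (\<Sum>k<m. (\<Sum>l<m. U $$ (i, l) * v $ l) * cnj (v $ k) * cnj (U $$ (j, k)))"
    unfolding mult_index[OF Uo mat_adjoint_carrier[OF U] ij]
  proof (intro sum.cong refl)
    fix k assume "k \<in> {..<m}"
    then have k: "k < m" by simp
    have "(\<Sum>l<m. U $$ (i, l) * outer_prod v v $$ (l, k)) = (\<Sum>l<m. U $$ (i, l) * v $ l) * cnj (v $ k)"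
      unfolding sum_distrib_right by (intro sum.cong refl) (use k in \<open>simp add: outer_prod_index[OF v v]\<close>)
    then show "(U * outer_prod v v) $$ (i, k) * mat_adjoint U $$ (k, j)
        = (\<Sum>l<m. U $$ (i, l) * v $ l) * cnj (v $ k) * cnj (U $$ (j, k))"
      unfolding mult_index[OF U o ij(1) k] using k ij U by simp
  qed
  also have "\<dots> = (\<Sum>l<m. U $$ (i, l) * v $ l) * cnj (\<Sum>k<m. U $$ (j, k) * v $ k)"
    unfolding cnj_sum sum_distrib_left by (intro sum.cong refl) (simp add: mult_ac)
  also have "\<dots> = outer_prod (U *\<^sub>v v) (U *\<^sub>v v) $$ (i, j)"
    unfolding outer_prod_index[OF Uv Uv ij] mult_vec_index[OF U v ij(1)] mult_vec_index[OF U v ij(2)] ..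
  finally show "(U * outer_prod v v * mat_adjoint U) $$ (i, j) = outer_prod (U *\<^sub>v v) (U *\<^sub>v v) $$ (i, j)" .
qed

lemma outer_prod_phase:
  assumes v: "v \<in> carrier_vec n" and z: "cmod z = 1"
  shows "outer_prod (z \<cdot>\<^sub>v v) (z \<cdot>\<^sub>v v) = outer_prod v v"
proof -
  have "z * x * (cnj z * cnj y) = x * cnj y" for x y
  proof -
    have "z * x * (cnj z * cnj y) = (z * cnj z) * (x * cnj y)" by (simp only: mult_ac)
    then show ?thesis using z by (simp add: mult_cnj_self)
  qed
  then show ?thesis using v unfolding outer_prod_def by (intro eq_matI) simp_all
qed

lemma pure_qubit_tensor_power:
  assumes "pure_qubit \<pi>"
  shows "\<exists>v \<in> carrier_vec (2 ^ k). v \<bullet>c v = 1 \<and> tensor_power \<pi> k = outer_prod v v"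
proof -
  obtain \<psi> where \<psi>: "\<psi> \<in> carrier_vec 2" "\<psi> \<bullet>c \<psi> = 1" "\<pi> = outer_prod \<psi> \<psi>"
    using assms unfolding pure_qubit_def by auto
  show ?thesis
  proof (induction k)
    case 0
    let ?v = "vec 1 (\<lambda>_. 1 :: complex)"
    have v: "?v \<in> carrier_vec (2 ^ 0)" by simp
    have "?v \<bullet>c ?v = 1" unfolding cscalar_prod_sum[OF v v] by simp
    moreover have "tensor_power \<pi> 0 = outer_prod ?v ?v"
      by (rule eq_matI) (auto simp: outer_prod_def)
    ultimately show ?case using v by blast
  next
    case (Suc k)
    then obtain w where w: "w \<in> carrier_vec (2 ^ k)" "w \<bullet>c w = 1" "tensor_power \<pi> k = outer_prod w w"
      by blast
    let ?v = "vec (2 * 2 ^ k) (\<lambda>i. \<psi> $ (i div 2 ^ k) * w $ (i mod 2 ^ k))"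
    have v: "?v \<in> carrier_vec (2 * 2 ^ k)" by simp
    have "?v \<bullet>c ?v = (\<Sum>i<2. \<Sum>j<2 ^ k. (\<psi> $ i * cnj (\<psi> $ i)) * (w $ j * cnj (w $ j)))"
    proof -
      have "i * 2 ^ k + j < 2 * 2 ^ k" if "i < 2" "j < 2 ^ k" for i j :: nat
        using that by (auto simp: less_2_cases_iff)
      then have "?v $ (i * 2 ^ k + j) * cnj (?v $ (i * 2 ^ k + j)) = (\<psi> $ i * cnj (\<psi> $ i)) * (w $ j * cnj (w $ j))"
        if "i < 2" "j < 2 ^ k" for i j
        using that by (simp add: mult_ac)
      then show ?thesis
        unfolding cscalar_prod_sum[OF v v] sum_lessThan_mult by (intro sum.cong refl) simp
    qed
    also have "\<dots> = (\<Sum>i<2. \<psi> $ i * cnj (\<psi> $ i)) * (\<Sum>j<2 ^ k. w $ j * cnj (w $ j))"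
      by (rule sum_product[symmetric])
    also have "\<dots> = 1"
      using \<psi>(2) w(2) unfolding cscalar_prod_sum[OF \<psi>(1) \<psi>(1)] cscalar_prod_sum[OF w(1) w(1)] by simp
    finally have "?v \<bullet>c ?v = 1" .
    moreover have "tensor_power \<pi> (Suc k) = outer_prod ?v ?v"
      using \<psi>(1) w(1) less_mult_imp_div_less[of _ 2 "2 ^ k"] unfolding tensor_power.simps w(3) unfolding \<psi>(3)
      by (intro eq_matI) (auto simp: outer_prod_def tensor_mat_def)
    ultimately show ?case using v unfolding power_Suc by blast
  qed
qed

section \<open>Partial traces and the rank of outputs\<close>

lemma discard_index_less:
  fixes i b p q :: nat
  assumes "i < 2 ^ (p + q)" "b < 2"
  shows "(2 * (i div 2 ^ q) + b) * 2 ^ q + i mod 2 ^ q < 2 ^ (p + 1 + q)"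
proof -
  have "i div 2 ^ q < 2 ^ p"
    using assms(1) by (intro less_mult_imp_div_less) (simp add: power_add)
  then have "2 * (i div 2 ^ q) + b + 1 \<le> 2 * 2 ^ p" using assms(2) by simp
  then have le: "(2 * (i div 2 ^ q) + b + 1) * 2 ^ q \<le> 2 * 2 ^ p * 2 ^ q" by (rule mult_right_mono) simp
  have "(2 * (i div 2 ^ q) + b) * 2 ^ q + i mod 2 ^ q < (2 * (i div 2 ^ q) + b) * 2 ^ q + 2 ^ q" by simp
  also have "\<dots> = (2 * (i div 2 ^ q) + b + 1) * 2 ^ q" by (simp only: distrib_right mult_1)
  also have "\<dots> \<le> 2 ^ (p + 1 + q)" using le by (simp add: power_add)
  finally show ?thesis .
qed

lemma discard_qubit_trace:
  assumes "A \<in> carrier_mat (2 ^ (p + 1 + q)) (2 ^ (p + 1 + q))"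
  shows "mat_trace (discard_qubit p q A) = mat_trace A"
proof -
  have "mat_trace (discard_qubit p q A) = (\<Sum>i<2 ^ p * 2 ^ q. \<Sum>b<2.
      A $$ ((2 * (i div 2 ^ q) + b) * 2 ^ q + i mod 2 ^ q, (2 * (i div 2 ^ q) + b) * 2 ^ q + i mod 2 ^ q))"
    unfolding mat_trace_def discard_qubit_def by (simp add: power_add)
  also have "\<dots> = (\<Sum>x<2 ^ p. \<Sum>y<2 ^ q. \<Sum>b<2. A $$ ((x * 2 + b) * 2 ^ q + y, (x * 2 + b) * 2 ^ q + y))"
    unfolding sum_lessThan_mult by (intro sum.cong refl) (simp add: mult.commute)
  also have "\<dots> = (\<Sum>x<2 ^ p. \<Sum>b<2. \<Sum>y<2 ^ q. A $$ ((x * 2 + b) * 2 ^ q + y, (x * 2 + b) * 2 ^ q + y))"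
    by (intro sum.cong refl sum.swap)
  also have "\<dots> = (\<Sum>i<2 ^ p * 2 * 2 ^ q. A $$ (i, i))"
    unfolding sum_lessThan_mult[of _ "2 ^ p * 2"] sum_lessThan_mult[of _ "2 ^ p"] ..
  also have "2 ^ p * 2 * 2 ^ q = dim_row A"
    using assms by (simp add: power_add mult_ac)
  finally show ?thesis unfolding mat_trace_def[of A] .
qed

text \<open>No rule adds a qubit. This makes the natural-number subtraction in the exponent
  \<open>k - m\<close> a genuine difference.\<close>

lemma noiseless_op_le: "noiseless_op k m \<Lambda> \<Longrightarrow> m \<le> k"
  by (induction rule: noiseless_op.induct) auto

text \<open>A unitary replaces \<open>V\<close> by \<open>U * V\<close>. A partial trace over one
  qubit sums two products, one for each value of the lost bit, which equals a single product for the
  two row blocks of \<open>V\<close> placed side by side: the column count doubles. Under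
  composition the exponents add.\<close>

lemma noiseless_op_factor:
  assumes "noiseless_op k m \<Lambda>" "V \<in> carrier_mat (2 ^ k) r"
  shows "\<exists>V' \<in> carrier_mat (2 ^ m) (r * 2 ^ (k - m)). \<Lambda> (V * mat_adjoint V) = V' * mat_adjoint V' \<and>
    mat_trace (V' * mat_adjoint V') = mat_trace (V * mat_adjoint V)"
  using assms
proof (induction arbitrary: V r rule: noiseless_op.induct)
  case (unitary k U)
  note V = unitary.prems and u = unitary_matD[OF unitary.hyps(1)]
  note V' = mat_adjoint_carrier[OF V]
  have UV: "U * V \<in> carrier_mat (2 ^ k) r" by (rule mult_carrier_mat[OF u(1) V])
  have eq: "U * (V * mat_adjoint V) * mat_adjoint U = U * V * mat_adjoint (U * V)"
    unfolding mat_adjoint_mult[OF u(1) V]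
    by (simp only: assoc_mult_mat[OF u(1) V V', symmetric] assoc_mult_mat[OF UV V' u(2)])
  have "mat_adjoint (U * V) * (U * V) = mat_adjoint V * V"
    unfolding mat_adjoint_mult[OF u(1) V]
    by (simp only: assoc_mult_mat[OF V' u(2) UV] assoc_mult_mat[OF u(2,1) V, symmetric] u(4)
        left_mult_one_mat[OF V])
  then have "mat_trace (U * V * mat_adjoint (U * V)) = mat_trace (V * mat_adjoint V)"
    using mat_trace_comm[OF UV mat_adjoint_carrier[OF UV]] mat_trace_comm[OF V V'] by simp
  then show ?case using UV eq by auto
next
  case (discard p q V)
  let ?x = "\<lambda>i b. (2 * (i div 2 ^ q) + b) * 2 ^ q + i mod 2 ^ q"
  let ?d = "2 ^ (p + 1 + q)" and ?e = "2 ^ (p + q)"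
  note V = discard.prems
  have VV: "V * mat_adjoint V \<in> carrier_mat ?d ?d"
    by (rule mult_carrier_mat[OF V mat_adjoint_carrier[OF V]])
  \<comment> \<open>The discarded bit migrates from the row index to the column index: column
    \<open>c\<close> encodes the old column \<open>c div 2\<close> and the bit
    \<open>c mod 2\<close>.\<close>
  define V' where "V' = mat ?e (r * 2) (\<lambda>(i, c). V $$ (?x i (c mod 2), c div 2))"
  have V': "V' \<in> carrier_mat ?e (r * 2)" unfolding V'_def by simp
  have "discard_qubit p q (V * mat_adjoint V) = V' * mat_adjoint V'"
  proof (rule eq_matI)
    fix i j assume "i < dim_row (V' * mat_adjoint V')" "j < dim_col (V' * mat_adjoint V')"
    then have ij: "i < ?e" "j < ?e" using V' by auto
    have "(V' * mat_adjoint V') $$ (i, j) = (\<Sum>c<r * 2. V' $$ (i, c) * cnj (V' $$ (j, c)))"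
      unfolding mult_index[OF V' mat_adjoint_carrier[OF V'] ij]
      using V' ij by (intro sum.cong refl) simp
    also have "\<dots> = (\<Sum>c<r. \<Sum>b<2. V $$ (?x i b, c) * cnj (V $$ (?x j b, c)))"
      unfolding sum_lessThan_mult
    proof (intro sum.cong refl)
      fix c b :: nat assume "c \<in> {..<r}" "b \<in> {..<2}"
      then have "c * 2 + b < r * 2" "(c * 2 + b) div 2 = c" "(c * 2 + b) mod 2 = b" by auto
      then show "V' $$ (i, c * 2 + b) * cnj (V' $$ (j, c * 2 + b)) = V $$ (?x i b, c) * cnj (V $$ (?x j b, c))"
        unfolding V'_def using ij by simp
    qed
    also have "\<dots> = (\<Sum>b<2. \<Sum>c<r. V $$ (?x i b, c) * cnj (V $$ (?x j b, c)))"
      by (rule sum.swap)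
    also have "\<dots> = (\<Sum>b<2. (V * mat_adjoint V) $$ (?x i b, ?x j b))"
    proof (intro sum.cong refl)
      fix b :: nat assume "b \<in> {..<2}"
      then have b: "?x i b < ?d" "?x j b < ?d" using discard_index_less ij by auto
      show "(\<Sum>c<r. V $$ (?x i b, c) * cnj (V $$ (?x j b, c))) = (V * mat_adjoint V) $$ (?x i b, ?x j b)"
        unfolding mult_index[OF V mat_adjoint_carrier[OF V] b]
        using V b by (intro sum.cong refl) simp
    qed
    finally show "discard_qubit p q (V * mat_adjoint V) $$ (i, j) = (V' * mat_adjoint V') $$ (i, j)"
      unfolding discard_qubit_def using ij by simp
  qed (use V' in \<open>auto simp: discard_qubit_def\<close>)
  then show ?case using V' discard_qubit_trace[OF VV] by (intro bexI[of _ V']) auto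
next
  case (compose k l \<Lambda> m \<Lambda>')
  obtain V' where V': "V' \<in> carrier_mat (2 ^ l) (r * 2 ^ (k - l))" "\<Lambda> (V * mat_adjoint V) = V' * mat_adjoint V'"
      "mat_trace (V' * mat_adjoint V') = mat_trace (V * mat_adjoint V)"
    using compose.IH(1)[OF compose.prems] by blast
  have eq: "r * 2 ^ (k - l) * 2 ^ (l - m) = r * 2 ^ (k - m)"
    using noiseless_op_le[OF compose.hyps(1)] noiseless_op_le[OF compose.hyps(2)]
    by (simp flip: power_add)
  then show ?case using compose.IH(2)[OF V'(1)] V'(2,3) unfolding eq by simp
qed

text \<open>The input has one column, so only the doublings count. The unit trace is recorded
  because the distance bound for low-rank states asks for it.\<close>

lemma noiseless_op_pure_output:
  assumes "noiseless_op k m \<Lambda>" "pure_qubit \<pi>"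
  shows "\<exists>V \<in> carrier_mat (2 ^ m) (2 ^ (k - m)). \<Lambda> (tensor_power \<pi> k) = V * mat_adjoint V \<and>
    mat_trace (V * mat_adjoint V) = 1"
proof -
  obtain v where v: "v \<in> carrier_vec (2 ^ k)" "v \<bullet>c v = 1" "tensor_power \<pi> k = outer_prod v v"
    using pure_qubit_tensor_power[OF assms(2)] by blast
  obtain V where V: "V \<in> carrier_mat (2 ^ k) 1" "outer_prod v v = V * mat_adjoint V"
    using outer_prod_factor[OF v(1)] by blast
  have "mat_trace (V * mat_adjoint V) = 1"
    using outer_prod_trace[OF v(1)] v(2) V(2) by simp
  then show ?thesis
    using noiseless_op_factor[OF assms(1) V(1)] unfolding v(3) V(2) by simp
qed

lemma discard_last_qubits:
  "\<exists>\<Lambda>. noiseless_op (m + a) m \<Lambda> \<and> (\<forall>A \<in> carrier_mat (2 ^ (m + a)) (2 ^ (m + a)).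
     \<Lambda> A = mat (2 ^ m) (2 ^ m) (\<lambda>(i, j). \<Sum>c<2 ^ a. A $$ (i * 2 ^ a + c, j * 2 ^ a + c)))"
proof (induction a)
  case 0
  \<comment> \<open>There is no rule for the identity map; discarding nothing is conjugation by the
    unit matrix.\<close>
  have one: "mat_adjoint (1\<^sub>m d) = (1\<^sub>m d :: complex mat)" for d by (rule eq_matI) auto
  have "1\<^sub>m (2 ^ m) * A * mat_adjoint (1\<^sub>m (2 ^ m))
      = mat (2 ^ m) (2 ^ m) (\<lambda>(i, j). \<Sum>c<2 ^ 0. A $$ (i * 2 ^ 0 + c, j * 2 ^ 0 + c))"
    if "A \<in> carrier_mat (2 ^ m) (2 ^ m)" for A :: "complex mat"
    unfolding one left_mult_one_mat[OF that] right_mult_one_mat[OF that]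
    by (rule eq_matI) (use that in auto)
  then show ?case using noiseless_op.unitary[OF unitary_mat_one[of "2 ^ m"]] by auto
next
  case (Suc a)
  then obtain \<Lambda> where \<Lambda>: "noiseless_op (m + a) m \<Lambda>"
    "\<And>A. A \<in> carrier_mat (2 ^ (m + a)) (2 ^ (m + a)) \<Longrightarrow>
      \<Lambda> A = mat (2 ^ m) (2 ^ m) (\<lambda>(i, j). \<Sum>c<2 ^ a. A $$ (i * 2 ^ a + c, j * 2 ^ a + c))"
    by blast
  \<comment> \<open>With second parameter 0 the discarded qubit is the least significant digit, so
    row \<open>i\<close> splits into rows \<open>2 * i + b\<close>.\<close>
  have "noiseless_op (m + Suc a) m (\<lambda>A. \<Lambda> (discard_qubit (m + a) 0 A))"
    using noiseless_op.compose[OF noiseless_op.discard[of "m + a" 0]] \<Lambda>(1) by simp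
  moreover have "\<Lambda> (discard_qubit (m + a) 0 A)
      = mat (2 ^ m) (2 ^ m) (\<lambda>(i, j). \<Sum>c<2 ^ Suc a. A $$ (i * 2 ^ Suc a + c, j * 2 ^ Suc a + c))" for A
  proof -
    have d: "discard_qubit (m + a) 0 A \<in> carrier_mat (2 ^ (m + a)) (2 ^ (m + a))"
      unfolding discard_qubit_def by simp
    show ?thesis
      unfolding \<Lambda>(2)[OF d]
    proof (rule cong_mat[OF refl refl], unfold split_conv)
      fix i j :: nat assume ij: "i < 2 ^ m" "j < 2 ^ m"
      have less: "i * 2 ^ a + c < 2 ^ (m + a)" if "i < 2 ^ m" "c < 2 ^ a" for i c :: nat
      proof -
        have "i * 2 ^ a + c < (i + 1) * 2 ^ a" using that(2) by simp
        also have "\<dots> \<le> 2 ^ m * 2 ^ a" using that(1) by (intro mult_right_mono) auto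
        finally show ?thesis by (simp add: power_add)
      qed
      have "(\<Sum>c<2 ^ a. discard_qubit (m + a) 0 A $$ (i * 2 ^ a + c, j * 2 ^ a + c))
          = (\<Sum>c<2 ^ a. \<Sum>b<2. A $$ (i * 2 ^ Suc a + (c * 2 + b), j * 2 ^ Suc a + (c * 2 + b)))"
      proof (intro sum.cong refl)
        fix c :: nat assume "c \<in> {..<2 ^ a}"
        then have "discard_qubit (m + a) 0 A $$ (i * 2 ^ a + c, j * 2 ^ a + c)
            = (\<Sum>b<2. A $$ (2 * (i * 2 ^ a + c) + b, 2 * (j * 2 ^ a + c) + b))"
          using less ij unfolding discard_qubit_def by simp
        moreover have "2 * (i * 2 ^ a + c) + b = i * 2 ^ Suc a + (c * 2 + b)" for i b :: nat by simp
        ultimately show "discard_qubit (m + a) 0 A $$ (i * 2 ^ a + c, j * 2 ^ a + c)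
            = (\<Sum>b<2. A $$ (i * 2 ^ Suc a + (c * 2 + b), j * 2 ^ Suc a + (c * 2 + b)))" by (simp only:)
      qed
      also have "\<dots> = (\<Sum>c<2 ^ Suc a. A $$ (i * 2 ^ Suc a + c, j * 2 ^ Suc a + c))"
        unfolding power_Suc2[of "2::nat" a]
        by (rule sum_lessThan_mult[where f = "\<lambda>c. A $$ (i * (2 ^ a * 2) + c, j * (2 ^ a * 2) + c)", symmetric])
      finally show "(\<Sum>c<2 ^ a. discard_qubit (m + a) 0 A $$ (i * 2 ^ a + c, j * 2 ^ a + c))
          = (\<Sum>c<2 ^ Suc a. A $$ (i * 2 ^ Suc a + c, j * 2 ^ Suc a + c))" .
    qed
  qed
  ultimately show ?case by blast
qed

text \<open>A purification needs an ancilla dimension no larger than the number of nonzero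
  eigenvalues. Hence \<open>a\<close> extra qubits suffice as soon as the support of
  \<open>q\<close> has at most \<open>2 ^ a\<close> elements, however large \<open>m\<close>
  is.\<close>

lemma noiseless_preparation:
  assumes W: "unitary_mat (2 ^ m) W" and q: "\<And>x. x < 2 ^ m \<Longrightarrow> 0 \<le> q x" "(\<Sum>x<2 ^ m. q x) = 1"
    and card: "card {x. x < 2 ^ m \<and> q x \<noteq> 0} \<le> 2 ^ a" and "pure_qubit \<pi>"
  shows "\<exists>\<Lambda>. noiseless_op (m + a) m \<Lambda> \<and> \<Lambda> (tensor_power \<pi> (m + a)) = conj_diag (2 ^ m) W q"
proof -
  note w = unitary_matD[OF W]
  let ?d = "2 ^ (m + a)"
  define S where "S = {x. x < 2 ^ m \<and> q x \<noteq> 0}"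
  have S: "finite S" "S \<subseteq> {..<2 ^ m}" "card S \<le> 2 ^ a" using card unfolding S_def by auto
  obtain g where g: "bij_betw g {0..<card S} S" using ex_bij_betw_nat_finite[OF S(1)] by blast
  have gS: "g c \<in> S" if "c < card S" for c using g that by (auto simp: bij_betw_def)
  \<comment> \<open>Amplitudes of a purification: the ancilla label \<open>c\<close> enumerates the support of \<open>q\<close>.\<close>
  define f where "f x c = (if c < card S then complex_of_real (sqrt (q (g c))) * W $$ (x, g c) else 0)" for x c
  have ff: "(\<Sum>c<2 ^ a. f i c * cnj (f j c)) = conj_diag (2 ^ m) W q $$ (i, j)" if "i < 2 ^ m" "j < 2 ^ m" for i j
  proof -
    let ?h = "\<lambda>x. W $$ (i, x) * q x * cnj (W $$ (j, x))"
    have "(\<Sum>c<2 ^ a. f i c * cnj (f j c)) = (\<Sum>c\<in>{0..<card S}. f i c * cnj (f j c))"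
      by (rule sum.mono_neutral_right) (use S(3) in \<open>auto simp: f_def\<close>)
    also have "\<dots> = (\<Sum>c\<in>{0..<card S}. ?h (g c))"
    proof (intro sum.cong refl)
      fix c assume "c \<in> {0..<card S}"
      then have c: "c < card S" by simp
      have "0 \<le> q (g c)" using gS[OF c] S(2) q(1) by auto
      then have sq: "complex_of_real (sqrt (q (g c))) * complex_of_real (sqrt (q (g c))) = q (g c)"
        unfolding of_real_mult[symmetric] by simp
      show "f i c * cnj (f j c) = ?h (g c)"
        unfolding f_def sq[symmetric] using c by (simp add: mult_ac)
    qed
    also have "\<dots> = (\<Sum>x\<in>S. ?h x)" by (rule sum.reindex_bij_betw[OF g])
    also have "\<dots> = (\<Sum>x<2 ^ m. ?h x)"
      by (rule sum.mono_neutral_left) (auto simp: S_def)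
    finally show ?thesis unfolding conj_diag_index[OF w(1) that] .
  qed
  define \<Psi> where "\<Psi> = vec ?d (\<lambda>i. f (i div 2 ^ a) (i mod 2 ^ a))"
  have \<Psi>: "\<Psi> \<in> carrier_vec ?d" unfolding \<Psi>_def by simp
  have \<Psi>i: "\<Psi> $ (i * 2 ^ a + c) = f i c" "i * 2 ^ a + c < ?d" if "i < 2 ^ m" "c < 2 ^ a" for i c
  proof -
    have "i * 2 ^ a + c < (i + 1) * 2 ^ a" using that(2) by simp
    also have "\<dots> \<le> 2 ^ m * 2 ^ a" using that(1) by (intro mult_right_mono) auto
    finally show "i * 2 ^ a + c < ?d" by (simp add: power_add)
    then show "\<Psi> $ (i * 2 ^ a + c) = f i c" unfolding \<Psi>_def using that by simp
  qed
  have norm: "\<Psi> \<bullet>c \<Psi> = 1"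
  proof -
    have "\<Psi> \<bullet>c \<Psi> = (\<Sum>i<2 ^ m. \<Sum>c<2 ^ a. \<Psi> $ (i * 2 ^ a + c) * cnj (\<Psi> $ (i * 2 ^ a + c)))"
      unfolding cscalar_prod_sum[OF \<Psi> \<Psi>] power_add sum_lessThan_mult ..
    also have "\<dots> = (\<Sum>i<2 ^ m. \<Sum>c<2 ^ a. f i c * cnj (f i c))"
      by (intro sum.cong refl) (use \<Psi>i in simp)
    also have "\<dots> = (\<Sum>i<2 ^ m. conj_diag (2 ^ m) W q $$ (i, i))"
      by (intro sum.cong refl) (use ff in simp)
    also have "\<dots> = mat_trace (conj_diag (2 ^ m) W q)"
      unfolding mat_trace_def using conj_diag_carrier[OF w(1), of q] by simp
    also have "\<dots> = complex_of_real (\<Sum>x<2 ^ m. q x)" unfolding conj_diag_trace[OF W] by simp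
    finally show ?thesis unfolding q(2) by simp
  qed
  obtain v where v: "v \<in> carrier_vec ?d" "v \<bullet>c v = 1" "tensor_power \<pi> (m + a) = outer_prod v v"
    using pure_qubit_tensor_power[OF \<open>pure_qubit \<pi>\<close>] by blast
  \<comment> \<open>Input and purification are unit vectors on the same \<open>m + a\<close> qubits,
    so one unitary connects them up to a phase, which the outer product removes.\<close>
  obtain U z where U: "unitary_mat ?d U" "cmod z = 1" "U *\<^sub>v v = z \<cdot>\<^sub>v \<Psi>"
    using householder_exists[OF v(1,2) \<Psi> norm] by blast
  obtain \<Lambda> where \<Lambda>: "noiseless_op (m + a) m \<Lambda>" "\<And>A. A \<in> carrier_mat ?d ?d \<Longrightarrow>
      \<Lambda> A = mat (2 ^ m) (2 ^ m) (\<lambda>(i, j). \<Sum>c<2 ^ a. A $$ (i * 2 ^ a + c, j * 2 ^ a + c))"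
    using discard_last_qubits by blast
  have "\<Lambda> (U * tensor_power \<pi> (m + a) * mat_adjoint U) = \<Lambda> (outer_prod \<Psi> \<Psi>)"
    unfolding v(3) outer_prod_conjugate[OF unitary_matD(1)[OF U(1)] v(1)] U(3) outer_prod_phase[OF \<Psi> U(2)] ..
  also have "\<dots> = conj_diag (2 ^ m) W q"
    unfolding \<Lambda>(2)[OF outer_prod_carrier[OF \<Psi> \<Psi>]]
  proof (rule eq_matI)
    note c = conj_diag_carrier[OF w(1), of q]
    fix i j assume "i < dim_row (conj_diag (2 ^ m) W q)" "j < dim_col (conj_diag (2 ^ m) W q)"
    then have ij: "i < 2 ^ m" "j < 2 ^ m" using c by auto
    have "(\<Sum>c<2 ^ a. outer_prod \<Psi> \<Psi> $$ (i * 2 ^ a + c, j * 2 ^ a + c)) = (\<Sum>c<2 ^ a. f i c * cnj (f j c))"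
      by (intro sum.cong refl) (use ij \<Psi>i outer_prod_index[OF \<Psi> \<Psi>] in simp)
    then show "mat (2 ^ m) (2 ^ m) (\<lambda>(i, j). \<Sum>c<2 ^ a. outer_prod \<Psi> \<Psi> $$ (i * 2 ^ a + c, j * 2 ^ a + c)) $$ (i, j)
        = conj_diag (2 ^ m) W q $$ (i, j)"
      using ij ff by simp
  qed (use conj_diag_carrier[OF w(1), of q] in auto)
  finally show ?thesis
    using noiseless_op.compose[OF noiseless_op.unitary[OF U(1)] \<Lambda>(1)] by blast
qed

section \<open>Tensor powers and typical sequences\<close>

lemma tensor_mat_carrier:
  "A \<in> carrier_mat a b \<Longrightarrow> B \<in> carrier_mat c d \<Longrightarrow> A \<otimes>\<^sub>m B \<in> carrier_mat (a * c) (b * d)"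
  unfolding tensor_mat_def by auto

lemma tensor_mat_index:
  assumes "A \<in> carrier_mat a b" "B \<in> carrier_mat c d" "i < a * c" "j < b * d"
  shows "(A \<otimes>\<^sub>m B) $$ (i, j) = A $$ (i div c, j div d) * B $$ (i mod c, j mod d)"
  using assms unfolding tensor_mat_def by auto

lemma unitary_mat_tensor:
  assumes U: "unitary_mat a U" and V: "unitary_mat b V"
  shows "unitary_mat (a * b) (U \<otimes>\<^sub>m V)"
proof (rule unitary_matI)
  note u = unitary_matD(1)[OF U] and v = unitary_matD(1)[OF V]
  show UV: "U \<otimes>\<^sub>m V \<in> carrier_mat (a * b) (a * b)" by (rule tensor_mat_carrier[OF u v])
  show "mat_adjoint (U \<otimes>\<^sub>m V) * (U \<otimes>\<^sub>m V) = 1\<^sub>m (a * b)"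
  proof (rule eq_matI)
    fix i j assume "i < dim_row (1\<^sub>m (a * b))" "j < dim_col (1\<^sub>m (a * b))"
    then have ij: "i < a * b" "j < a * b" by auto
    then have "b > 0" by (cases b) auto
    have i: "i div b < a" "i mod b < b" and j: "j div b < a" "j mod b < b"
      using ij \<open>b > 0\<close> by (auto intro: less_mult_imp_div_less)
    have "(mat_adjoint (U \<otimes>\<^sub>m V) * (U \<otimes>\<^sub>m V)) $$ (i, j)
        = (\<Sum>k<a * b. cnj ((U \<otimes>\<^sub>m V) $$ (k, i)) * (U \<otimes>\<^sub>m V) $$ (k, j))"
      unfolding mult_index[OF mat_adjoint_carrier[OF UV] UV ij]
      using UV ij by (intro sum.cong refl) simp
    also have "\<dots> = (\<Sum>k<a. \<Sum>k'<b. (cnj (U $$ (k, i div b)) * U $$ (k, j div b)) *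
        (cnj (V $$ (k', i mod b)) * V $$ (k', j mod b)))"
      unfolding sum_lessThan_mult
    proof (intro sum.cong refl)
      fix k k' assume "k \<in> {..<a}" "k' \<in> {..<b}"
      then have k: "k < a" "k' < b" by auto
      have "k * b + k' < (k + 1) * b" using k(2) by simp
      also have "\<dots> \<le> a * b" using k(1) by (intro mult_right_mono) auto
      finally have less: "k * b + k' < a * b" .
      show "cnj ((U \<otimes>\<^sub>m V) $$ (k * b + k', i)) * (U \<otimes>\<^sub>m V) $$ (k * b + k', j)
        = (cnj (U $$ (k, i div b)) * U $$ (k, j div b)) * (cnj (V $$ (k', i mod b)) * V $$ (k', j mod b))"
        unfolding tensor_mat_index[OF u v less ij(1)] tensor_mat_index[OF u v less ij(2)] using k by simp
    qed
    also have "\<dots> = (\<Sum>k<a. cnj (U $$ (k, i div b)) * U $$ (k, j div b)) *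
        (\<Sum>k'<b. cnj (V $$ (k', i mod b)) * V $$ (k', j mod b))"
      by (rule sum_product[symmetric])
    also have "\<dots> = (if i div b = j div b \<and> i mod b = j mod b then 1 else 0)"
      unfolding unitary_mat_cols[OF U i(1) j(1)] unitary_mat_cols[OF V i(2) j(2)] by simp
    also have "\<dots> = 1\<^sub>m (a * b) $$ (i, j)"
      using ij by simp (metis div_mod_decomp)
    finally show "(mat_adjoint (U \<otimes>\<^sub>m V) * (U \<otimes>\<^sub>m V)) $$ (i, j) = 1\<^sub>m (a * b) $$ (i, j)" .
  qed (use UV in auto)
qed

text \<open>Eigenvalues multiply, indexed by quotient and remainder exactly as the entries of the
  tensor product are. The recursion of \<open>weight\<close> below copies this indexing.\<close>

lemma tensor_mat_conj_diag:
  assumes u: "U \<in> carrier_mat a a" and v: "V \<in> carrier_mat b b"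
  shows "conj_diag a U l \<otimes>\<^sub>m conj_diag b V m = conj_diag (a * b) (U \<otimes>\<^sub>m V) (\<lambda>i. l (i div b) * m (i mod b))"
proof (rule eq_matI)
  note UV = tensor_mat_carrier[OF u v]
  note cu = conj_diag_carrier[OF u, of l] and cv = conj_diag_carrier[OF v, of m]
  note c = conj_diag_carrier[OF UV, of "\<lambda>i. l (i div b) * m (i mod b)"]
  fix i j assume "i < dim_row (conj_diag (a * b) (U \<otimes>\<^sub>m V) (\<lambda>i. l (i div b) * m (i mod b)))"
    "j < dim_col (conj_diag (a * b) (U \<otimes>\<^sub>m V) (\<lambda>i. l (i div b) * m (i mod b)))"
  then have ij: "i < a * b" "j < a * b" using c by auto
  then have "b > 0" by (cases b) auto
  have i: "i div b < a" "i mod b < b" and j: "j div b < a" "j mod b < b"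
    using ij \<open>b > 0\<close> by (auto intro: less_mult_imp_div_less)
  have "conj_diag (a * b) (U \<otimes>\<^sub>m V) (\<lambda>i. l (i div b) * m (i mod b)) $$ (i, j)
      = (\<Sum>k<a. \<Sum>k'<b. (U $$ (i div b, k) * l k * cnj (U $$ (j div b, k))) *
        (V $$ (i mod b, k') * m k' * cnj (V $$ (j mod b, k'))))"
    unfolding conj_diag_index[OF UV ij] sum_lessThan_mult
  proof (intro sum.cong refl)
    fix k k' assume "k \<in> {..<a}" "k' \<in> {..<b}"
    then have k: "k < a" "k' < b" by auto
    have "k * b + k' < (k + 1) * b" using k(2) by simp
    also have "\<dots> \<le> a * b" using k(1) by (intro mult_right_mono) auto
    finally have less: "k * b + k' < a * b" .
    have k': "(k * b + k') div b = k" "(k * b + k') mod b = k'" using k by auto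
    show "(U \<otimes>\<^sub>m V) $$ (i, k * b + k') * complex_of_real (l ((k * b + k') div b) * m ((k * b + k') mod b)) *
        cnj ((U \<otimes>\<^sub>m V) $$ (j, k * b + k'))
      = (U $$ (i div b, k) * l k * cnj (U $$ (j div b, k))) * (V $$ (i mod b, k') * m k' * cnj (V $$ (j mod b, k')))"
      unfolding tensor_mat_index[OF u v ij(1) less] tensor_mat_index[OF u v ij(2) less] k'
      by (simp add: mult_ac)
  qed
  also have "\<dots> = (conj_diag a U l \<otimes>\<^sub>m conj_diag b V m) $$ (i, j)"
    unfolding tensor_mat_index[OF cu cv ij] conj_diag_index[OF u i(1) j(1)] conj_diag_index[OF v i(2) j(2)]
    by (rule sum_product[symmetric])
  finally show "(conj_diag a U l \<otimes>\<^sub>m conj_diag b V m) $$ (i, j)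
      = conj_diag (a * b) (U \<otimes>\<^sub>m V) (\<lambda>i. l (i div b) * m (i mod b)) $$ (i, j)" ..
qed (use conj_diag_carrier[OF tensor_mat_carrier[OF u v]] tensor_mat_carrier[OF conj_diag_carrier[OF u] conj_diag_carrier[OF v]]
    in \<open>metis carrier_matD\<close>)+

section \<open>Words over a finite probability vector and their typicality\<close>

locale prob_weights =
  fixes d :: nat and l :: "nat \<Rightarrow> real"
  assumes nonneg: "i < d \<Longrightarrow> 0 \<le> l i" and sum_one: "(\<Sum>i<d. l i) = 1"
begin

text \<open>The numbers \<open>x < d ^ n\<close> encode the words of length \<open>n\<close> over \<open>{..<d}\<close>, first letter most significant.
  A letter of weight \<open>0\<close> has surprisal \<open>- log 2 0 = 0\<close>, a junk value that only enters multiplied by \<open>0\<close>.\<close>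

primrec weight :: "nat \<Rightarrow> nat \<Rightarrow> real" where
  "weight 0 x = 1"
| "weight (Suc n) x = l (x div d ^ n) * weight n (x mod d ^ n)"

primrec surprisal :: "nat \<Rightarrow> nat \<Rightarrow> real" where
  "surprisal 0 x = 0"
| "surprisal (Suc n) x = - log 2 (l (x div d ^ n)) + surprisal n (x mod d ^ n)"

definition entropy :: real where "entropy = - (\<Sum>i<d. l i * log 2 (l i))"

text \<open>The variance of the surprisal of one letter; it is the constant in all Chebyshev bounds
  below.\<close>

definition varentropy :: real where "varentropy = (\<Sum>i<d. l i * (- log 2 (l i) - entropy)\<^sup>2)"

lemma dim_pos: "d > 0"
  using sum_one by (cases d) auto

lemma digits_less: "x < d ^ Suc n \<Longrightarrow> x div d ^ n < d \<and> x mod d ^ n < d ^ n"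
  using dim_pos by (auto intro: less_mult_imp_div_less)

lemma weight_nonneg: "x < d ^ n \<Longrightarrow> 0 \<le> weight n x"
  by (induction n arbitrary: x) (use digits_less nonneg in auto)

text \<open>The logarithm of a product splits only if no factor vanishes; a positive product of
  nonnegative factors guarantees this.\<close>

lemma surprisal_weight: "x < d ^ n \<Longrightarrow> weight n x > 0 \<Longrightarrow> surprisal n x = - log 2 (weight n x)"
proof (induction n arbitrary: x)
  case (Suc n)
  have x: "x div d ^ n < d" "x mod d ^ n < d ^ n" using digits_less[OF Suc.prems(1)] by auto
  have "l (x div d ^ n) > 0" "weight n (x mod d ^ n) > 0"
    using Suc.prems(2) nonneg[OF x(1)] weight_nonneg[OF x(2)] by (auto simp: zero_less_mult_iff)
  then show ?case using Suc.IH[OF x(2)] by (simp add: log_mult_pos)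
qed simp

lemma sum_digits:
  fixes f :: "nat \<Rightarrow> nat \<Rightarrow> real"
  shows "(\<Sum>x<d ^ Suc n. f (x div d ^ n) (x mod d ^ n)) = (\<Sum>i<d. \<Sum>y<d ^ n. f i y)"
  unfolding power_Suc sum_lessThan_mult by (intro sum.cong refl) simp

lemma weight_sum: "(\<Sum>x<d ^ n. weight n x) = 1"
proof (induction n)
  case (Suc n)
  have "(\<Sum>x<d ^ Suc n. weight (Suc n) x) = (\<Sum>i<d. l i) * (\<Sum>y<d ^ n. weight n y)"
    unfolding weight.simps sum_digits[of "\<lambda>i y. l i * weight n y"] by (rule sum_product[symmetric])
  then show ?case using Suc sum_one by simp
qed simp

lemma surprisal_step_mean: "(\<Sum>i<d. l i * (- log 2 (l i) - entropy)) = 0"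
proof -
  have "(\<Sum>i<d. l i * (- log 2 (l i) - entropy)) = entropy - (\<Sum>i<d. l i) * entropy"
    unfolding sum_distrib_right entropy_def by (simp add: algebra_simps sum_subtractf sum_negf)
  then show ?thesis using sum_one by simp
qed

text \<open>Variances of independent letters add: in the expanded square the cross term carries the
  centred first moment \<open>surprisal_step_mean\<close>, which is zero.\<close>

lemma surprisal_variance: "(\<Sum>x<d ^ n. weight n x * (surprisal n x - n * entropy)\<^sup>2) = n * varentropy"
proof (induction n)
  case (Suc n)
  let ?a = "\<lambda>i. - log 2 (l i) - entropy" and ?b = "\<lambda>y. surprisal n y - n * entropy"
  have "(\<Sum>x<d ^ Suc n. weight (Suc n) x * (surprisal (Suc n) x - Suc n * entropy)\<^sup>2)
      = (\<Sum>i<d. \<Sum>y<d ^ n. l i * weight n y * (?a i + ?b y)\<^sup>2)"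
    unfolding sum_digits[symmetric] by (intro sum.cong refl) (simp add: algebra_simps)
  also have "\<dots> = (\<Sum>i<d. \<Sum>y<d ^ n. (l i * (?a i)\<^sup>2) * weight n y
      + (l i * ?a i) * (2 * (weight n y * ?b y)) + l i * (weight n y * (?b y)\<^sup>2))"
    by (intro sum.cong refl) (simp only: power2_sum, simp only: algebra_simps)
  also have "\<dots> = (\<Sum>i<d. l i * (?a i)\<^sup>2) * (\<Sum>y<d ^ n. weight n y)
      + (\<Sum>i<d. l i * ?a i) * (\<Sum>y<d ^ n. 2 * (weight n y * ?b y))
      + (\<Sum>i<d. l i) * (\<Sum>y<d ^ n. weight n y * (?b y)\<^sup>2)"
    unfolding sum.distrib sum_product ..
  finally show ?case
    unfolding Suc surprisal_step_mean weight_sum sum_one varentropy_def[symmetric] by (simp add: algebra_simps)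
qed simp

text \<open>The deviation is required only where the weight is positive, so the default surprisals
  of words of weight zero never have to be estimated.\<close>

lemma surprisal_chebyshev:
  assumes "n > 0" "\<epsilon> > 0" and B: "B \<subseteq> {..<d ^ n}"
    "\<And>x. x \<in> B \<Longrightarrow> weight n x > 0 \<Longrightarrow> \<bar>surprisal n x - n * entropy\<bar> \<ge> n * \<epsilon>"
  shows "(\<Sum>x\<in>B. weight n x) \<le> varentropy / (n * \<epsilon>\<^sup>2)"
proof -
  have "(\<Sum>x\<in>B. weight n x) * (n * \<epsilon>)\<^sup>2 \<le> (\<Sum>x\<in>B. weight n x * (surprisal n x - n * entropy)\<^sup>2)"
    unfolding sum_distrib_right
  proof (rule sum_mono)
    fix x assume x: "x \<in> B"
    then have w: "0 \<le> weight n x" using B(1) weight_nonneg by auto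
    show "weight n x * (n * \<epsilon>)\<^sup>2 \<le> weight n x * (surprisal n x - n * entropy)\<^sup>2"
    proof (cases "weight n x = 0")
      case False
      then have "n * \<epsilon> \<le> \<bar>surprisal n x - n * entropy\<bar>" using B(2)[OF x] w by simp
      then have "(n * \<epsilon>)\<^sup>2 \<le> \<bar>surprisal n x - n * entropy\<bar>\<^sup>2"
        using assms by (intro power_mono) auto
      then show ?thesis using w by (intro mult_left_mono) auto
    qed simp
  qed
  also have "\<dots> \<le> (\<Sum>x<d ^ n. weight n x * (surprisal n x - n * entropy)\<^sup>2)"
    using B(1) weight_nonneg by (intro sum_mono2) auto
  also have "\<dots> = n * varentropy" by (rule surprisal_variance)
  finally show ?thesis
    using assms(1,2) by (simp add: field_simps power2_eq_square)
qed

text \<open>Large weight means surprisal below the mean; this tail enters the converse. The opposite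
  tail, treated next, controls the error of the direct part.\<close>

lemma heavy_weight_bound:
  assumes "n > 0" "\<epsilon> > 0"
  shows "(\<Sum>x | x < d ^ n \<and> weight n x > 2 powr (- (n * (entropy - \<epsilon>))). weight n x) \<le> varentropy / (n * \<epsilon>\<^sup>2)"
proof (rule surprisal_chebyshev[OF assms])
  fix x assume "x \<in> {x. x < d ^ n \<and> weight n x > 2 powr (- (n * (entropy - \<epsilon>)))}"
    and pos: "weight n x > 0"
  then have x: "x < d ^ n" "2 powr (- (n * (entropy - \<epsilon>))) < weight n x" by auto
  have "- (n * (entropy - \<epsilon>)) < log 2 (weight n x)"
    using x(2) pos by (simp add: less_log_iff)
  then show "n * \<epsilon> \<le> \<bar>surprisal n x - n * entropy\<bar>"
    unfolding surprisal_weight[OF x(1) pos] by (simp add: algebra_simps)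
qed auto

lemma light_weight_bound:
  assumes "n > 0" "\<epsilon> > 0"
  shows "(\<Sum>x | x < d ^ n \<and> weight n x < 2 powr (- (n * (entropy + \<epsilon>))). weight n x) \<le> varentropy / (n * \<epsilon>\<^sup>2)"
proof (rule surprisal_chebyshev[OF assms])
  fix x assume "x \<in> {x. x < d ^ n \<and> weight n x < 2 powr (- (n * (entropy + \<epsilon>)))}"
    and pos: "weight n x > 0"
  then have x: "x < d ^ n" "weight n x < 2 powr (- (n * (entropy + \<epsilon>)))" by auto
  have "log 2 (weight n x) < - (n * (entropy + \<epsilon>))"
    using x(2) pos by (simp add: log_less_iff)
  then show "n * \<epsilon> \<le> \<bar>surprisal n x - n * entropy\<bar>"
    unfolding surprisal_weight[OF x(1) pos] by (simp add: algebra_simps)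
qed auto

text \<open>Each counted word contributes at least \<open>2 powr (- K)\<close> to a total weight of
  1.\<close>

lemma card_typical_le:
  "card {x. x < d ^ n \<and> weight n x \<ge> 2 powr (- K)} \<le> 2 powr K"
proof -
  let ?T = "{x. x < d ^ n \<and> weight n x \<ge> 2 powr (- K)}"
  have "card ?T * 2 powr (- K) = (\<Sum>x\<in>?T. 2 powr (- K))" by simp
  also have "\<dots> \<le> (\<Sum>x\<in>?T. weight n x)" by (rule sum_mono) simp
  also have "\<dots> \<le> (\<Sum>x<d ^ n. weight n x)" by (rule sum_mono2) (use weight_nonneg in auto)
  also have "\<dots> = 1" by (rule weight_sum)
  finally show ?thesis by (simp add: powr_minus field_simps)
qed

text \<open>Weights are at most 1. The sign keeps the exponent
  \<open>n * (entropy + \<epsilon>)\<close> nonnegative, so that a point mass meets the cardinality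
  bound and the number of ancillas can be taken as a ceiling.\<close>

lemma entropy_nonneg: "entropy \<ge> 0"
proof -
  have "l i * log 2 (l i) \<le> 0" if "i < d" for i
  proof -
    have "l i \<le> (\<Sum>i<d. l i)" using that nonneg by (intro member_le_sum) auto
    then have "l i \<le> 1" using sum_one by simp
    then show ?thesis
      using nonneg[OF that] by (cases "l i = 0") (auto intro!: mult_nonneg_nonpos simp: log_le_zero_cancel_iff)
  qed
  then have "(\<Sum>i<d. l i * log 2 (l i)) \<le> 0" by (intro sum_nonpos) simp
  then show ?thesis unfolding entropy_def by simp
qed

text \<open>\<open>q\<close> is the word distribution conditioned on \<open>T\<close>. The set is
  one-sided: heavy words are kept, since only light words spoil the count. The factor 2 is the mass
  lost on \<open>L\<close> plus the equal mass gained on \<open>T\<close> by renormalising.\<close>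

lemma typical_approximation:
  assumes "n > 0" "\<epsilon> > 0"
  shows "\<exists>q. (\<forall>x. 0 \<le> q x) \<and> (\<Sum>x<d ^ n. q x) = 1 \<and>
    card {x. x < d ^ n \<and> q x \<noteq> 0} \<le> 2 powr (n * (entropy + \<epsilon>)) \<and>
    (\<Sum>x<d ^ n. \<bar>q x - weight n x\<bar>) \<le> 2 * (varentropy / (n * \<epsilon>\<^sup>2))"
proof -
  define K where "K = n * (entropy + \<epsilon>)"
  define T where "T = {x. x < d ^ n \<and> weight n x \<ge> 2 powr (- K)}"
  define L where "L = {x. x < d ^ n \<and> weight n x < 2 powr (- K)}"
  have fin: "finite T" "finite L" unfolding T_def L_def by auto
  have TL: "{..<d ^ n} = T \<union> L" "T \<inter> L = {}" unfolding T_def L_def by auto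
  have split: "(\<Sum>x<d ^ n. f x) = (\<Sum>x\<in>T. f x) + (\<Sum>x\<in>L. f x)" for f :: "nat \<Rightarrow> real"
    unfolding TL(1) by (rule sum.union_disjoint[OF fin TL(2)])
  have K: "K \<ge> 0" unfolding K_def using entropy_nonneg assms by simp
  define t where "t = (\<Sum>x\<in>T. weight n x)"
  have t: "t + (\<Sum>x\<in>L. weight n x) = 1" using weight_sum[of n] unfolding split t_def .
  have w0: "0 \<le> weight n x" if "x \<in> T \<union> L" for x using that weight_nonneg unfolding TL(1)[symmetric] by simp
  have light: "1 - t \<le> varentropy / (n * \<epsilon>\<^sup>2)"
    using light_weight_bound[OF assms] t unfolding K_def L_def by simp
  have t0: "t \<ge> 0" unfolding t_def by (rule sum_nonneg) (use w0 in simp)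
  show ?thesis
  proof (cases "t = 0")
    case True
    \<comment> \<open>Then the bound is at least \<open>2\<close>, and any point mass will do.\<close>
    define q where "q x = (if x = 0 then 1 else 0 :: real)" for x :: nat
    have d: "0 < d ^ n" using dim_pos by simp
    then have q1: "(\<Sum>x<d ^ n. q x) = 1" unfolding q_def by simp
    have "{x. x < d ^ n \<and> q x \<noteq> 0} = {0}" using d unfolding q_def by auto
    then have "real (card {x. x < d ^ n \<and> q x \<noteq> 0}) \<le> 2 powr K" using K by (simp add: ge_one_powr_ge_zero)
    moreover have "(\<Sum>x<d ^ n. \<bar>q x - weight n x\<bar>) \<le> (\<Sum>x<d ^ n. q x + weight n x)"
      using weight_nonneg by (intro sum_mono) (auto simp: q_def abs_le_iff)
    then have "(\<Sum>x<d ^ n. \<bar>q x - weight n x\<bar>) \<le> 2 * (varentropy / (n * \<epsilon>\<^sup>2))"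
      unfolding sum.distrib weight_sum q1 using light True by linarith
    ultimately show ?thesis using q1 unfolding K_def by (intro exI[of _ q]) (auto simp: q_def)
  next
    case False
    then have tp: "t > 0" using t0 by simp
    define q where "q x = (if x \<in> T then weight n x / t else 0)" for x
    have qL: "q x = 0" if "x \<in> L" for x using that TL(2) unfolding q_def by auto
    have "0 \<le> q x" for x unfolding q_def using w0 tp by simp
    moreover have "(\<Sum>x<d ^ n. q x) = 1"
    proof -
      have "(\<Sum>x\<in>T. q x) = 1"
        unfolding q_def using tp by (simp add: sum_divide_distrib[symmetric] t_def[symmetric])
      then show ?thesis unfolding split using qL by simp
    qed
    moreover have "real (card {x. x < d ^ n \<and> q x \<noteq> 0}) \<le> 2 powr K"
    proof -
      have "card {x. x < d ^ n \<and> q x \<noteq> 0} \<le> card T"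
        by (rule card_mono[OF fin(1)]) (auto simp: q_def split: if_splits)
      then show ?thesis using card_typical_le[of n K] unfolding T_def[symmetric] by linarith
    qed
    moreover have "(\<Sum>x<d ^ n. \<bar>q x - weight n x\<bar>) \<le> 2 * (varentropy / (n * \<epsilon>\<^sup>2))"
    proof -
      have "t \<le> 1" using t sum_nonneg[of L "weight n"] w0 by auto
      have "(\<Sum>x\<in>T. \<bar>q x - weight n x\<bar>) = (\<Sum>x\<in>T. weight n x * (1 / t - 1))"
      proof (rule sum.cong[OF refl])
        fix x assume x: "x \<in> T"
        then have "q x - weight n x = weight n x * (1 / t - 1)"
          unfolding q_def by (simp add: algebra_simps)
        moreover have "0 \<le> weight n x * (1 / t - 1)" using w0 x tp \<open>t \<le> 1\<close> by simp
        ultimately show "\<bar>q x - weight n x\<bar> = weight n x * (1 / t - 1)" by simp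
      qed
      also have "\<dots> = 1 - t"
        unfolding sum_distrib_right[symmetric] t_def[symmetric] using tp by (simp add: field_simps)
      finally have "(\<Sum>x\<in>T. \<bar>q x - weight n x\<bar>) = 1 - t" .
      moreover have "(\<Sum>x\<in>L. \<bar>q x - weight n x\<bar>) = (\<Sum>x\<in>L. weight n x)"
        by (rule sum.cong) (use qL w0 in auto)
      ultimately show ?thesis unfolding split using light t by linarith
    qed
    ultimately show ?thesis unfolding K_def by (intro exI[of _ q]) simp
  qed
qed

text \<open>The bridge from operators to words: with \<open>l\<close> the spectrum of one copy, the
  word weights are the spectrum of \<open>n\<close> copies.\<close>

lemma tensor_power_conj_diag:
  assumes U: "unitary_mat d U"
  shows "unitary_mat (d ^ n) (tensor_power U n) \<and>
    tensor_power (conj_diag d U l) n = conj_diag (d ^ n) (tensor_power U n) (weight n)"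
proof (induction n)
  case 0
  have one: "1\<^sub>m (Suc 0) \<in> carrier_mat (Suc 0) (Suc 0)" by simp
  have "1\<^sub>m 1 = conj_diag 1 (1\<^sub>m 1) (weight 0)"
    unfolding One_nat_def
    by (rule eq_matI) (use carrier_matD[OF conj_diag_carrier[OF one, of "weight 0"]] in
      \<open>auto simp: conj_diag_index[OF one]\<close>)
  then show ?case using unitary_mat_one[of 1] by (simp only: tensor_power.simps power_0 simp_thms)
next
  case (Suc n)
  then have n: "unitary_mat (d ^ n) (tensor_power U n)"
    "tensor_power (conj_diag d U l) n = conj_diag (d ^ n) (tensor_power U n) (weight n)" by auto
  have "tensor_power (conj_diag d U l) (Suc n) = conj_diag (d * d ^ n) (U \<otimes>\<^sub>m tensor_power U n)
      (\<lambda>i. l (i div d ^ n) * weight n (i mod d ^ n))"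
    unfolding tensor_power.simps n(2) by (rule tensor_mat_conj_diag[OF unitary_matD(1)[OF U] unitary_matD(1)[OF n(1)]])
  moreover have "(\<lambda>i. l (i div d ^ n) * weight n (i mod d ^ n)) = weight (Suc n)" by (rule ext) simp
  ultimately show ?case using unitary_mat_tensor[OF U n(1)] by simp
qed

end

section \<open>Optimal rate\<close>

lemma positive_semidefinite_hermitian:
  assumes "positive_semidefinite d A"
  shows "mat_adjoint A = A"
proof (rule eq_matI)
  have A: "A \<in> carrier_mat d d" using assms unfolding positive_semidefinite_def by blast
  show "dim_row (mat_adjoint A) = dim_row A" "dim_col (mat_adjoint A) = dim_col A" using A by auto
  fix i j assume "i < dim_row A" "j < dim_col A"
  then have ij: "i < d" "j < d" using A by auto
  have form: "Im (cnj x * (x * A $$ (i, i) + y * A $$ (i, j)) + cnj y * (x * A $$ (j, i) + y * A $$ (j, j))) = 0" for x y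
  proof -
    define v where "v = vec d (\<lambda>k. (if k = i then x else 0) + (if k = j then y else 0))"
    have v: "v \<in> carrier_vec d" unfolding v_def by simp
    have Av: "A *\<^sub>v v \<in> carrier_vec d" using A v by simp
    \<comment> \<open>Stated for \<open>v\<close> unconjugated; the inner product, which conjugates
      \<open>v\<close>, is therefore rewritten below as the conjugate of a conjugate.\<close>
    have sum: "(\<Sum>k<d. g k * v $ k) = x * g i + y * g j" for g
    proof -
      have "(\<Sum>k<d. g k * v $ k) = (\<Sum>k<d. (if k = i then x * g k else 0) + (if k = j then y * g k else 0))"
        unfolding v_def by (intro sum.cong refl) (auto simp: algebra_simps)
      then show ?thesis using ij by (simp add: sum.distrib)
    qed
    have "(A *\<^sub>v v) \<bullet>c v = cnj (\<Sum>k<d. cnj ((A *\<^sub>v v) $ k) * v $ k)"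
      unfolding cscalar_prod_sum[OF Av v] by simp
    also have "\<dots> = cnj x * (A *\<^sub>v v) $ i + cnj y * (A *\<^sub>v v) $ j"
      unfolding sum by simp
    also have "\<dots> = cnj x * (x * A $$ (i, i) + y * A $$ (i, j)) + cnj y * (x * A $$ (j, i) + y * A $$ (j, j))"
      unfolding mult_vec_index[OF A v ij(1)] mult_vec_index[OF A v ij(2)] sum ..
    finally show ?thesis
      using assms v unfolding positive_semidefinite_def by (auto simp: less_eq_complex_def)
  qed
  \<comment> \<open>Polarisation: coefficients (1, 0) and (0, 1) make the diagonal real, (1, 1)
    makes the imaginary parts of the two off-diagonal entries opposite, and (1, \<i>) makes their
    real parts equal.\<close>
  have "Im (A $$ (i, i)) = 0" "Im (A $$ (j, j)) = 0"
    using form[of 1 0] form[of 0 1] by simp_all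
  then have "A $$ (i, j) = cnj (A $$ (j, i))"
    using form[of 1 1] form[of 1 \<i>] by (simp add: complex_eq_iff)
  then show "mat_adjoint A $$ (i, j) = A $$ (i, j)" using A ij by simp
qed

text \<open>The quadratic form at a unit eigenvector returns the eigenvalue, which transfers
  positivity of the form to \<open>l\<close>.\<close>

lemma conj_diag_eigenvalue:
  assumes U: "unitary_mat d U" and k: "k < d"
  shows "(conj_diag d U l *\<^sub>v col U k) \<bullet>c col U k = complex_of_real (l k)"
proof -
  note u = unitary_matD[OF U]
  have v: "col U k \<in> carrier_vec d" by (rule col_carrier_vec[OF k u(1)])
  have Av: "(conj_diag d U l *\<^sub>v col U k) $ i = l k * U $$ (i, k)" if i: "i < d" for i
  proof -
    have "(conj_diag d U l *\<^sub>v col U k) $ i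
        = (\<Sum>j<d. (\<Sum>m<d. U $$ (i, m) * l m * cnj (U $$ (j, m))) * U $$ (j, k))"
      unfolding mult_vec_index[OF conj_diag_carrier[OF u(1)] v i]
    proof (intro sum.cong refl)
      fix j assume "j \<in> {..<d}"
      then have j: "j < d" by simp
      show "conj_diag d U l $$ (i, j) * col U k $ j = (\<Sum>m<d. U $$ (i, m) * l m * cnj (U $$ (j, m))) * U $$ (j, k)"
        unfolding conj_diag_index[OF u(1) i j] using u(1) j k by simp
    qed
    also have "\<dots> = (\<Sum>m<d. U $$ (i, m) * l m * (\<Sum>j<d. cnj (U $$ (j, m)) * U $$ (j, k)))"
      unfolding sum_distrib_left sum_distrib_right by (subst sum.swap) (simp add: mult_ac)
    also have "\<dots> = (\<Sum>m<d. if m = k then U $$ (i, m) * l m else 0)"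
      by (intro sum.cong refl) (use unitary_mat_cols[OF U _ k] in simp)
    finally show ?thesis using k by (simp add: mult.commute)
  qed
  have "(conj_diag d U l *\<^sub>v col U k) \<bullet>c col U k = (\<Sum>i<d. l k * (cnj (U $$ (i, k)) * U $$ (i, k)))"
    unfolding cscalar_prod_sum[OF mult_mat_vec_carrier[OF conj_diag_carrier[OF u(1)] v] v]
    by (intro sum.cong refl) (use Av u(1) k in \<open>simp add: mult_ac\<close>)
  then show ?thesis
    unfolding sum_distrib_left[symmetric] unitary_mat_cols[OF U k k] by simp
qed

lemma qubit_state_diagonalization:
  assumes "qubit_state N \<rho>"
  shows "\<exists>U l. unitary_mat (2 ^ N) U \<and> prob_weights (2 ^ N) l \<and> \<rho> = conj_diag (2 ^ N) U l"
proof -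
  have psd: "positive_semidefinite (2 ^ N) \<rho>" and tr: "mat_trace \<rho> = 1"
    using assms unfolding qubit_state_def by auto
  then have "\<rho> \<in> carrier_mat (2 ^ N) (2 ^ N)" unfolding positive_semidefinite_def by blast
  then obtain U l where U: "unitary_mat (2 ^ N) U" and \<rho>: "\<rho> = conj_diag (2 ^ N) U l"
    using hermitian_diagonalization positive_semidefinite_hermitian[OF psd] by blast
  have "0 \<le> l k" if "k < 2 ^ N" for k
  proof -
    have "col U k \<in> carrier_vec (2 ^ N)" by (rule col_carrier_vec[OF that unitary_matD(1)[OF U]])
    then have "0 \<le> complex_of_real (l k)"
      using psd conj_diag_eigenvalue[OF U that] unfolding positive_semidefinite_def \<rho> by metis
    then show ?thesis by (simp add: less_eq_complex_def)
  qed
  moreover have "(\<Sum>i<2 ^ N. l i) = 1"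
  proof -
    have "complex_of_real (\<Sum>i<2 ^ N. l i) = complex_of_real 1"
      using tr unfolding \<rho> conj_diag_trace[OF U] by simp
    then show ?thesis by (simp only: of_real_eq_iff)
  qed
  ultimately show ?thesis using U \<rho> by (intro exI[of _ U] exI[of _ l]) (auto intro: prob_weights.intro)
qed

section \<open>Converse and direct bounds on the rate\<close>

lemma tendsto_const_over_n: "(\<lambda>n. c / (real n * e)) \<longlonglongrightarrow> 0"
proof -
  have "(\<lambda>n. (c / e) * (1 / real n)) \<longlonglongrightarrow> (c / e) * 0"
    by (intro tendsto_mult tendsto_const lim_1_over_n)
  then show ?thesis by (simp add: mult.commute)
qed

lemma achievable_rate_ge:
  assumes U: "unitary_mat (2 ^ N) U" and l: "prob_weights (2 ^ N) l" and "pure_qubit \<pi>"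
    and r: "r \<in> achievable_rates \<pi> N (conj_diag (2 ^ N) U l)"
  shows "N + prob_weights.entropy (2 ^ N) l \<le> r"
proof (rule ccontr)
  interpret prob_weights "2 ^ N" l by (rule l)
  assume "\<not> N + entropy \<le> r"
  \<comment> \<open>A third of the gap: one part absorbs the fluctuation of \<open>k n / n\<close>
    around \<open>r\<close>, one the slack in the eigenvalue threshold, and the last remains as the
    decay \<open>2 powr (- \<epsilon>)\<close> per copy.\<close>
  define \<epsilon> where "\<epsilon> = (N + entropy - r) / 3"
  have \<epsilon>: "\<epsilon> > 0" using \<open>\<not> N + entropy \<le> r\<close> unfolding \<epsilon>_def by simp
  let ?\<rho> = "conj_diag (2 ^ N) U l"
  obtain k \<Lambda> where k: "(\<lambda>n. real (k n) / real n) \<longlonglongrightarrow> r"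
    and \<Lambda>: "\<And>n. n \<ge> 1 \<Longrightarrow> noiseless_op (k n) (n * N) (\<Lambda> n)"
    and lim: "(\<lambda>n. trace_norm (\<Lambda> n (tensor_power \<pi> (k n)) - tensor_power ?\<rho> n)) \<longlonglongrightarrow> 0"
    using r unfolding achievable_rates_def by blast
  let ?t = "\<lambda>n. trace_norm (\<Lambda> n (tensor_power \<pi> (k n)) - tensor_power ?\<rho> n)"
  have bound: "1 \<le> ?t n + varentropy / (n * \<epsilon>\<^sup>2) + (2 powr (- \<epsilon>)) ^ n"
    if n: "n \<ge> 1" and kn: "real (k n) / real n < r + \<epsilon>" for n
  proof -
    obtain V where V: "V \<in> carrier_mat (2 ^ (n * N)) (2 ^ (k n - n * N))"
      "\<Lambda> n (tensor_power \<pi> (k n)) = V * mat_adjoint V" "mat_trace (V * mat_adjoint V) = 1"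
      using noiseless_op_pure_output[OF \<Lambda>[OF n] \<open>pure_qubit \<pi>\<close>] by blast
    let ?\<theta> = "2 powr (- (n * (entropy - \<epsilon>)))"
    have dim: "(2 ^ N) ^ n = (2 :: nat) ^ (n * N)" by (simp add: power_mult[symmetric] mult.commute)
    note tp = tensor_power_conj_diag[OF U, of n, unfolded dim]
    have "1 \<le> trace_norm (V * mat_adjoint V - conj_diag (2 ^ (n * N)) (tensor_power U n) (weight n))
        + (\<Sum>i | i < 2 ^ (n * N) \<and> weight n i > ?\<theta>. weight n i) + ?\<theta> * (2 ^ (k n - n * N) :: nat)"
      by (rule low_rank_trace_norm_bound[OF V(1) refl V(3)])
        (use tp weight_nonneg[of _ n, unfolded dim] in auto)
    then have "1 \<le> ?t n + (\<Sum>i | i < 2 ^ (n * N) \<and> weight n i > ?\<theta>. weight n i) + ?\<theta> * 2 ^ (k n - n * N)"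
      using tp unfolding V(2) by simp
    moreover have "(\<Sum>i | i < 2 ^ (n * N) \<and> weight n i > ?\<theta>. weight n i) \<le> varentropy / (n * \<epsilon>\<^sup>2)"
      using heavy_weight_bound[of n \<epsilon>, unfolded dim] n \<epsilon> by simp
    moreover have "?\<theta> * 2 ^ (k n - n * N) \<le> (2 powr (- \<epsilon>)) ^ n"
    proof -
      have "real (k n) < n * (r + \<epsilon>)" using kn n by (simp add: field_simps)
      moreover have "n * (r + \<epsilon>) = n * entropy + n * N - 2 * (n * \<epsilon>)"
      proof -
        have r: "r = N + entropy - 3 * \<epsilon>" unfolding \<epsilon>_def by (simp add: field_simps)
        show ?thesis by (subst r) (simp add: algebra_simps)
      qed
      ultimately have le: "- (n * (entropy - \<epsilon>)) + (real (k n) - n * N) \<le> - (n * \<epsilon>)"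
        by (simp add: algebra_simps)
      \<comment> \<open>The natural-number exponent becomes a real difference because the operation
        cannot have fewer inputs than outputs.\<close>
      have "?\<theta> * 2 ^ (k n - n * N) = 2 powr (- (n * (entropy - \<epsilon>)) + (real (k n) - n * N))"
        unfolding powr_add using noiseless_op_le[OF \<Lambda>[OF n]]
        by (simp add: powr_realpow[symmetric] of_nat_diff)
      also have "\<dots> \<le> 2 powr (- (n * \<epsilon>))" using le by simp
      also have "\<dots> = (2 powr (- \<epsilon>)) ^ n" by (simp add: powr_realpow[symmetric] powr_powr mult.commute)
      finally show ?thesis .
    qed
    ultimately show ?thesis by linarith
  qed
  have "\<forall>\<^sub>F n in sequentially. real (k n) / real n < r + \<epsilon>"
    using order_tendstoD(2)[OF k, of "r + \<epsilon>"] \<epsilon> by simp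
  then have ev: "\<forall>\<^sub>F n in sequentially. 1 \<le> ?t n + varentropy / (n * \<epsilon>\<^sup>2) + (2 powr (- \<epsilon>)) ^ n"
    using eventually_ge_at_top[of 1] by eventually_elim (rule bound)
  have "2 powr (- \<epsilon>) < 2 powr 0" using \<epsilon> by (intro powr_less_mono) auto
  then have "(\<lambda>n. (2 powr (- \<epsilon>)) ^ n) \<longlonglongrightarrow> 0" by (intro LIMSEQ_realpow_zero) auto
  then have "(\<lambda>n. ?t n + varentropy / (n * \<epsilon>\<^sup>2) + (2 powr (- \<epsilon>)) ^ n) \<longlonglongrightarrow> 0 + 0 + 0"
    by (intro tendsto_add lim tendsto_const_over_n)
  from tendsto_lowerbound[OF this ev] show False by simp
qed

text \<open>The number of discarded qubits is the ceiling of
  \<open>n * (entropy + \<epsilon>)\<close>; rounding costs at most one qubit per block and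
  disappears in the rate. A positive excess \<epsilon> is enough for the infimum.\<close>

lemma achievable_rateI:
  assumes U: "unitary_mat (2 ^ N) U" and l: "prob_weights (2 ^ N) l" and "pure_qubit \<pi>" and \<epsilon>: "\<epsilon> > 0"
  shows "N + prob_weights.entropy (2 ^ N) l + \<epsilon> \<in> achievable_rates \<pi> N (conj_diag (2 ^ N) U l)"
proof -
  interpret prob_weights "2 ^ N" l by (rule l)
  let ?\<rho> = "conj_diag (2 ^ N) U l"
  define a where "a n = nat \<lceil>n * (entropy + \<epsilon>)\<rceil>" for n :: nat
  have ent: "entropy + \<epsilon> > 0" using entropy_nonneg \<epsilon> by simp
  have a: "n * (entropy + \<epsilon>) \<le> a n" "a n \<le> n * (entropy + \<epsilon>) + 1" for n
    unfolding a_def using ent by (auto simp: of_nat_nat le_of_int_ceiling of_int_ceiling_le_add_one)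
  have "\<exists>\<Lambda>. noiseless_op (n * N + a n) (n * N) \<Lambda> \<and>
      0 \<le> trace_norm (\<Lambda> (tensor_power \<pi> (n * N + a n)) - tensor_power ?\<rho> n) \<and>
      trace_norm (\<Lambda> (tensor_power \<pi> (n * N + a n)) - tensor_power ?\<rho> n) \<le> 2 * varentropy / (n * \<epsilon>\<^sup>2)"
    if n: "n \<ge> 1" for n
  proof -
    have dim: "(2 ^ N) ^ n = (2 :: nat) ^ (n * N)" by (simp add: power_mult[symmetric] mult.commute)
    obtain q where q: "\<And>x. 0 \<le> q x" "(\<Sum>x<2 ^ (n * N). q x) = 1"
      "real (card {x. x < 2 ^ (n * N) \<and> q x \<noteq> 0}) \<le> 2 powr (n * (entropy + \<epsilon>))"
      "(\<Sum>x<2 ^ (n * N). \<bar>q x - weight n x\<bar>) \<le> 2 * (varentropy / (n * \<epsilon>\<^sup>2))"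
      using typical_approximation[OF _ \<epsilon>, of n, unfolded dim] n by auto
    have tp: "unitary_mat (2 ^ (n * N)) (tensor_power U n)"
      "tensor_power ?\<rho> n = conj_diag (2 ^ (n * N)) (tensor_power U n) (weight n)"
      using tensor_power_conj_diag[OF U, of n] unfolding dim by auto
    have "2 powr (n * (entropy + \<epsilon>)) \<le> 2 powr (real (a n))" using a(1) by simp
    also have "2 powr (real (a n)) = real (2 ^ a n)" by (simp add: powr_realpow)
    finally have "real (card {x. x < 2 ^ (n * N) \<and> q x \<noteq> 0}) \<le> real (2 ^ a n)"
      using q(3) by linarith
    then have "card {x. x < 2 ^ (n * N) \<and> q x \<noteq> 0} \<le> 2 ^ a n" by (simp only: of_nat_le_iff)
    then obtain \<Lambda> where \<Lambda>: "noiseless_op (n * N + a n) (n * N) \<Lambda>"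
      "\<Lambda> (tensor_power \<pi> (n * N + a n)) = conj_diag (2 ^ (n * N)) (tensor_power U n) q"
      using noiseless_preparation[OF tp(1) q(1) q(2) _ \<open>pure_qubit \<pi>\<close>] by blast
    have "trace_norm (\<Lambda> (tensor_power \<pi> (n * N + a n)) - tensor_power ?\<rho> n) = (\<Sum>x<2 ^ (n * N). \<bar>q x - weight n x\<bar>)"
      unfolding \<Lambda>(2) tp(2) conj_diag_minus[OF unitary_matD(1)[OF tp(1)]] by (rule trace_norm_conj_diag[OF tp(1)])
    then show ?thesis using \<Lambda>(1) q(4) by (intro exI[of _ \<Lambda>]) (simp add: sum_nonneg)
  qed
  \<comment> \<open>The condition \<open>n \<ge> 1\<close> moves inside the existential so that
    choice yields a total function of \<open>n\<close>.\<close>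
  then have "\<forall>n. \<exists>\<Lambda>. n \<ge> 1 \<longrightarrow> noiseless_op (n * N + a n) (n * N) \<Lambda> \<and>
      0 \<le> trace_norm (\<Lambda> (tensor_power \<pi> (n * N + a n)) - tensor_power ?\<rho> n) \<and>
      trace_norm (\<Lambda> (tensor_power \<pi> (n * N + a n)) - tensor_power ?\<rho> n) \<le> 2 * varentropy / (n * \<epsilon>\<^sup>2)"
    by blast
  from choice[OF this] obtain \<Lambda> where \<Lambda>: "\<forall>n. n \<ge> 1 \<longrightarrow> noiseless_op (n * N + a n) (n * N) (\<Lambda> n) \<and>
      0 \<le> trace_norm (\<Lambda> n (tensor_power \<pi> (n * N + a n)) - tensor_power ?\<rho> n) \<and>
      trace_norm (\<Lambda> n (tensor_power \<pi> (n * N + a n)) - tensor_power ?\<rho> n) \<le> 2 * varentropy / (n * \<epsilon>\<^sup>2)"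
    by (rule exE)
  have error: "(\<lambda>n. trace_norm (\<Lambda> n (tensor_power \<pi> (n * N + a n)) - tensor_power ?\<rho> n)) \<longlonglongrightarrow> 0"
  proof (rule tendsto_sandwich[OF _ _ tendsto_const tendsto_const_over_n])
    show "\<forall>\<^sub>F n in sequentially. 0 \<le> trace_norm (\<Lambda> n (tensor_power \<pi> (n * N + a n)) - tensor_power ?\<rho> n)"
      using eventually_ge_at_top[of 1] by eventually_elim (use \<Lambda> in blast)
    show "\<forall>\<^sub>F n in sequentially. trace_norm (\<Lambda> n (tensor_power \<pi> (n * N + a n)) - tensor_power ?\<rho> n)
        \<le> 2 * varentropy / (n * \<epsilon>\<^sup>2)"
      using eventually_ge_at_top[of 1] by eventually_elim (use \<Lambda> in blast)
  qed
  have rate: "(\<lambda>n. real (n * N + a n) / real n) \<longlonglongrightarrow> N + entropy + \<epsilon>"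
  proof (rule tendsto_sandwich[OF _ _ tendsto_const])
    show "\<forall>\<^sub>F n in sequentially. N + entropy + \<epsilon> \<le> real (n * N + a n) / real n"
      using eventually_ge_at_top[of 1]
    proof eventually_elim
      case (elim n)
      then show ?case using a(1)[of n] by (simp add: field_simps)
    qed
    \<comment> \<open>The last summand is the rounding cost, with the factor 1 written out to match
      \<open>tendsto_const_over_n\<close>.\<close>
    show "\<forall>\<^sub>F n in sequentially. real (n * N + a n) / real n \<le> N + entropy + \<epsilon> + 1 / (real n * 1)"
      using eventually_ge_at_top[of 1]
    proof eventually_elim
      case (elim n)
      have "real (a n) / n \<le> (n * (entropy + \<epsilon>) + 1) / n" using a(2)[of n] by (intro divide_right_mono) auto
      then show ?case using elim by (simp add: add_divide_distrib)
    qed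
    show "(\<lambda>n. N + entropy + \<epsilon> + 1 / (real n * 1)) \<longlonglongrightarrow> N + entropy + \<epsilon>"
      using tendsto_add[OF tendsto_const[of "N + entropy + \<epsilon>"] tendsto_const_over_n[of 1 1]] by simp
  qed
  show ?thesis
    unfolding achievable_rates_def
    by (intro CollectI exI[of _ "\<lambda>n. n * N + a n"] exI[of _ \<Lambda>] conjI rate error) (use \<Lambda> in blast)
qed

theorem proposition2:
  fixes N :: nat and \<rho> \<pi> :: "complex mat"
  assumes "qubit_state N \<rho>"
    and "pure_qubit \<pi>"
  shows "(INF r \<in> achievable_rates \<pi> N \<rho>. ereal r) = ereal (real N + von_neumann_entropy \<rho>)"
proof -
  obtain U l where U: "unitary_mat (2 ^ N) U" and l: "prob_weights (2 ^ N) l" and \<rho>: "\<rho> = conj_diag (2 ^ N) U l"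
    using qubit_state_diagonalization[OF assms(1)] by blast
  have S: "von_neumann_entropy \<rho> = prob_weights.entropy (2 ^ N) l"
    unfolding \<rho> entropy_conj_diag[OF U] prob_weights.entropy_def[OF l] ..
  show ?thesis
  proof (rule antisym)
    show "(INF r \<in> achievable_rates \<pi> N \<rho>. ereal r) \<le> ereal (real N + von_neumann_entropy \<rho>)"
    proof (rule ereal_le_epsilon2)
      fix e :: real assume "e > 0"
      have "(INF r \<in> achievable_rates \<pi> N \<rho>. ereal r) \<le> ereal (N + prob_weights.entropy (2 ^ N) l + e)"
        using achievable_rateI[OF U l assms(2) \<open>e > 0\<close>] unfolding \<rho> by (rule INF_lower)
      then show "(INF r \<in> achievable_rates \<pi> N \<rho>. ereal r) \<le> ereal (real N + von_neumann_entropy \<rho>) + ereal e"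
        unfolding S by simp
    qed
    show "ereal (real N + von_neumann_entropy \<rho>) \<le> (INF r \<in> achievable_rates \<pi> N \<rho>. ereal r)"
      using achievable_rate_ge[OF U l assms(2)] unfolding S unfolding \<rho> by (intro INF_greatest) simp
  qed
qed

end
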